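(* Let $(E,\mathcal{P})$ be a random locally convex module over $K$ with base $(\Omega,\mathcal{F},P)$. Then $E^{\ast}_{\varepsilon,\lambda}=H_{cc}(E^{\ast}_{c})$, where $E^{\ast}_{\varepsilon,\lambda}$ is the random conjugate space of $(E,\mathcal{P})$ under the $(\varepsilon,\lambda)$-topology, $E^{\ast}_{c}$ is the random conjugate space of $(E,\mathcal{P})$ under the locally $L^0$-convex topology, and $H_{cc}(E^{\ast}_{c})$ is the countable concatenation hull of $E^{\ast}_{c}$ in $E^{\ast}_{\varepsilon,\lambda}$.
   Context: $(\Omega,\mathcal{F},P)$ is a probability space and $K$ is $\mathbb{R}$ or $\mathbb{C}$. $L^0(\mathcal{F},K)$ is the algebra of equivalence classes (a.s. equality) of $K$-valued $\mathcal{F}$-measurable random variables, $L^0(\mathcal{F})=L^0(\mathcal{F},\mathbb{R})$, ordered by a.s. $\leq$; $L^0_+(\mathcal{F})=\{\xi\in L^0(\mathcal{F}):\xi\ge 0\}$, $L^0_{++}(\mathcal{F})=\{\xi\in L^0(\mathcal{F}):\xi>0 \text{ a.s.}\}$; $\tilde I_A$ is the class of the indicator of $A\in\mathcal{F}$. A countable partition $\{A_n,n\in\mathbb{N}\}$ of $\Omega$ to $\mathcal{F}$ is a sequence of pairwise disjoint members of $\mathcal{F}$ with union $\Omega$. Random locally convex module (RLC module) over $K$ with base $(\Omega,\mathcal{F},P)$: a pair $(E,\mathcal{P})$ with $E$ an $L^0(\mathcal{F},K)$-module and $\mathcal{P}$ a family of $L^0$-seminorms on $E$ (maps $\|\cdot\|:E\to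 L^0_+(\mathcal{F})$ with $\|\xi x\|=|\xi|\|x\|$ for $\xi\in L^0(\mathcal{F},K)$ and $\|x+y\|\le\|x\|+\|y\|$) such that $\bigvee\{\|x\|:\|\cdot\|\in\mathcal{P}\}=0$ iff $x=\theta$ (the null element of $E$). $\mathcal{P}_f$ is the family of (nonempty) finite subsets of $\mathcal{P}$, and $\|x\|_{\mathcal{Q}}=\bigvee\{\|x\|:\|\cdot\|\in\mathcal{Q}\}$ for $\mathcal{Q}\in\mathcal{P}_f$. The $(\varepsilon,\lambda)$-topology $\mathcal{T}_{\varepsilon,\lambda}$ on $E$ is the linear topology with local base at $\theta$ given by the sets $\{x\in E: P(\|x\|_{\mathcal{Q}}<\varepsilon)>1-\lambda\}$, $\mathcal{Q}\in\mathcal{P}_f$, real $\varepsilon>0$, $0<\lambda<1$. The locally $L^0$-convex topology $\mathcal{T}_c$ on $E$ has local base at $\theta$ given by the sets $\{x\in E:\|x\|_{\mathcal{Q}}\le\varepsilon\}$, $\mathcal{Q}\in\mathcal{P}_f$, $\varepsilon\in L^0_{++}(\mathcal{F})$. $L^0(\mathcal{F},K)$ carries the corresponding topologies $\mathcal{T}_{\varepsilon,\lambda}$ and $\mathcal{T}_c$ determined by the single $L^0$-norm $|\cdot|$. $E^\ast_{\varepsilon,\lambda}$ is the $L^0(\mathcal{F},K)$-module of continuous module homomorphisms from $(E,\mathcal{T}_{\varepsilon,\lambda})$ to $(L^0(\mathcal{F},K),\mathcal{T}_{\varepsilon,\lambda})$. $E^\ast_c$ is the $L^0(\mathcal{F},K)$-module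 of continuous module homomorphisms from $(E,\mathcal{T}_c)$ to $(L^0(\mathcal{F},K),\mathcal{T}_c)$. It is known that $E^\ast_c\subset E^\ast_{\varepsilon,\lambda}$ and that $E^\ast_{\varepsilon,\lambda}$ has the countable concatenation property, i.e. for each sequence $\{f_n\}$ in $E^\ast_{\varepsilon,\lambda}$ and each countable partition $\{A_n\}$ of $\Omega$ to $\mathcal{F}$ there is a (unique) $f\in E^\ast_{\varepsilon,\lambda}$ with $\tilde I_{A_n}f=\tilde I_{A_n}f_n$ for all $n$, denoted $\sum_{n=1}^\infty\tilde I_{A_n}f_n$. $H_{cc}(E^\ast_c)$ is the set of all $\sum_{n=1}^\infty\tilde I_{A_n}f_n$ with $\{A_n\}$ a countable partition of $\Omega$ to $\mathcal{F}$ and $\{f_n\}$ a sequence in $E^\ast_c$. *)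

theory Defs
  imports "HOL-Probability.Probability" "HOL-Algebra.Module"
begin

section \<open>The algebra of classes of random variables\<close>

text \<open>
  The scalar field \<open>K\<close> is a type of sort \<open>{real_normed_field, euclidean_space}\<close>.  The types
  \<^typ>\<open>real\<close> and \<^typ>\<open>complex\<close> have this sort, and by the theorem of Frobenius every type of this sort
  is isomorphic, as a normed field, to one of these two.  Elements of \<open>L0(F, K)\<close> are
  honest equivalence classes, i.e. sets of functions.
\<close>

definition ae_eq :: "'w measure \<Rightarrow> (('w \<Rightarrow> 'b::topological_space) \<times> ('w \<Rightarrow> 'b)) set" where
  "ae_eq M = {(f, g). f \<in> borel_measurable M \<and> g \<in> borel_measurable M \<and> (AE w in M. f w = g w)}"

definition L0_class :: "'w measure \<Rightarrow> ('w \<Rightarrow> 'b::topological_space) \<Rightarrow> ('w \<Rightarrow> 'b) set" where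
  "L0_class M f = ae_eq M `` {f}"

definition L0_rep :: "('w \<Rightarrow> 'b) set \<Rightarrow> 'w \<Rightarrow> 'b" where
  "L0_rep \<xi> = (SOME f. f \<in> \<xi>)"

definition L0 :: "'w measure \<Rightarrow> ('w \<Rightarrow> 'k::{real_normed_field, euclidean_space}) set ring" where
  "L0 M = \<lparr>carrier = borel_measurable M // ae_eq M,
           mult = (\<lambda>\<xi> \<eta>. L0_class M (\<lambda>w. L0_rep \<xi> w * L0_rep \<eta> w)),
           one = L0_class M (\<lambda>_. 1),
           zero = L0_class M (\<lambda>_. 0),
           add = (\<lambda>\<xi> \<eta>. L0_class M (\<lambda>w. L0_rep \<xi> w + L0_rep \<eta> w))\<rparr>"

definition L0_order :: "'w measure \<Rightarrow> ('w \<Rightarrow> real) set gorder" where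
  "L0_order M = \<lparr>carrier = carrier (L0 M), eq = (=),
                 le = (\<lambda>\<xi> \<eta>. AE w in M. L0_rep \<xi> w \<le> L0_rep \<eta> w)\<rparr>"

definition L0_nonneg :: "'w measure \<Rightarrow> ('w \<Rightarrow> real) set set" where
  "L0_nonneg M = {\<xi> \<in> carrier (L0 M). \<zero>\<^bsub>L0 M\<^esub> \<sqsubseteq>\<^bsub>L0_order M\<^esub> \<xi>}"

definition L0_pos :: "'w measure \<Rightarrow> ('w \<Rightarrow> real) set set" where
  "L0_pos M = {\<xi> \<in> carrier (L0 M). AE w in M. 0 < L0_rep \<xi> w}"

definition L0_abs ::
    "'w measure \<Rightarrow> ('w \<Rightarrow> 'k::{real_normed_field, euclidean_space}) set \<Rightarrow> ('w \<Rightarrow> real) set" where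
  "L0_abs M \<xi> = L0_class M (\<lambda>w. norm (L0_rep \<xi> w))"

definition L0_ind ::
    "'w measure \<Rightarrow> 'w set \<Rightarrow> ('w \<Rightarrow> 'k::{real_normed_field, euclidean_space}) set" where
  "L0_ind M A = L0_class M (indicator A)"

definition countable_partition :: "'w measure \<Rightarrow> (nat \<Rightarrow> 'w set) \<Rightarrow> bool" where
  "countable_partition M A \<longleftrightarrow>
     range A \<subseteq> sets M \<and> disjoint_family A \<and> (\<Union>n. A n) = space M"


section \<open>Random locally convex modules\<close>

definition L0_seminorm ::
    "'w measure \<Rightarrow> (('w \<Rightarrow> 'k::{real_normed_field, euclidean_space}) set, 'e, 'm) module_scheme
      \<Rightarrow> ('e \<Rightarrow> ('w \<Rightarrow> real) set) \<Rightarrow> bool" where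
  "L0_seminorm M E p \<longleftrightarrow>
     p \<in> carrier E \<rightarrow>\<^sub>E L0_nonneg M \<and>
     (\<forall>\<xi>\<in>carrier (L0 M). \<forall>x\<in>carrier E. p (\<xi> \<odot>\<^bsub>E\<^esub> x) = L0_abs M \<xi> \<otimes>\<^bsub>L0 M\<^esub> p x) \<and>
     (\<forall>x\<in>carrier E. \<forall>y\<in>carrier E. p (x \<oplus>\<^bsub>E\<^esub> y) \<sqsubseteq>\<^bsub>L0_order M\<^esub> p x \<oplus>\<^bsub>L0 M\<^esub> p y)"

text \<open>
  The supremum of an infinite family need not exist in \<open>L0(F)\<close>, so that the separation
  condition says that the class of \<open>0\<close> is the least upper bound, instead of using the total
  function \<^const>\<open>Lattice.sup\<close>.  It makes the family \<open>P\<close> nonempty.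
\<close>

locale RLC_module =
  prob_space M + E: Module.module "L0 M" E
  for M :: "'w measure"
    and E :: "(('w \<Rightarrow> 'k::{real_normed_field, euclidean_space}) set, 'e, 'm) module_scheme"
      (structure)
    and P :: "('e \<Rightarrow> ('w \<Rightarrow> real) set) set" +
  assumes seminorm: "p \<in> P \<Longrightarrow> L0_seminorm M E p"
    and separating:
      "x \<in> carrier E \<Longrightarrow>
         least (L0_order M) \<zero>\<^bsub>L0 M\<^esub> (Upper (L0_order M) ((\<lambda>p. p x) ` P)) \<longleftrightarrow> x = \<zero>\<^bsub>E\<^esub>"

definition fin_norm ::
    "'w measure \<Rightarrow> ('e \<Rightarrow> ('w \<Rightarrow> real) set) set \<Rightarrow> 'e \<Rightarrow> ('w \<Rightarrow> real) set" where
  "fin_norm M Q x = \<Squnion>\<^bsub>L0_order M\<^esub>((\<lambda>p. p x) ` Q)"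


section \<open>The two topologies\<close>

definition eps_lambda_base ::
    "'w measure \<Rightarrow> ('e, 'm) ring_scheme \<Rightarrow> ('e \<Rightarrow> ('w \<Rightarrow> real) set) set \<Rightarrow> 'e set set" where
  "eps_lambda_base M E P =
     {{x \<in> carrier E. measure M {w \<in> space M. L0_rep (fin_norm M Q x) w < \<epsilon>} > 1 - \<delta>} | Q \<epsilon> \<delta>.
        Q \<subseteq> P \<and> finite Q \<and> Q \<noteq> {} \<and> 0 < \<epsilon> \<and> 0 < \<delta> \<and> \<delta> < 1}"

definition L0_convex_base ::
    "'w measure \<Rightarrow> ('e, 'm) ring_scheme \<Rightarrow> ('e \<Rightarrow> ('w \<Rightarrow> real) set) set \<Rightarrow> 'e set set" where
  "L0_convex_base M E P =
     {{x \<in> carrier E. fin_norm M Q x \<sqsubseteq>\<^bsub>L0_order M\<^esub> \<epsilon>} | Q \<epsilon>.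
        Q \<subseteq> P \<and> finite Q \<and> Q \<noteq> {} \<and> \<epsilon> \<in> L0_pos M}"

text \<open>
  The translation invariant topology with a given local base at the null element.  The two
  bases above are directed (see below), so that the predicate is indeed a topology.
\<close>

definition translation_topology :: "('e, 'm) ring_scheme \<Rightarrow> 'e set set \<Rightarrow> 'e topology" where
  "translation_topology E B =
     topology (\<lambda>U. U \<subseteq> carrier E \<and> (\<forall>x\<in>U. \<exists>N\<in>B. (\<lambda>y. x \<oplus>\<^bsub>E\<^esub> y) ` N \<subseteq> U))"

definition eps_lambda_topology ::
    "'w measure \<Rightarrow> ('e, 'm) ring_scheme \<Rightarrow> ('e \<Rightarrow> ('w \<Rightarrow> real) set) set \<Rightarrow> 'e topology" where
  "eps_lambda_topology M E P = translation_topology E (eps_lambda_base M E P)"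

definition L0_convex_topology ::
    "'w measure \<Rightarrow> ('e, 'm) ring_scheme \<Rightarrow> ('e \<Rightarrow> ('w \<Rightarrow> real) set) set \<Rightarrow> 'e topology" where
  "L0_convex_topology M E P = translation_topology E (L0_convex_base M E P)"


section \<open>Random conjugate spaces and the countable concatenation hull\<close>

text \<open>Homomorphisms are extensional, so that equality in HOL is equality of maps on \<open>E\<close>.\<close>

definition L0_hom ::
    "'w measure \<Rightarrow> (('w \<Rightarrow> 'k::{real_normed_field, euclidean_space}) set, 'e, 'm) module_scheme
      \<Rightarrow> ('e \<Rightarrow> ('w \<Rightarrow> 'k) set) set" where
  "L0_hom M E =
     {f \<in> carrier E \<rightarrow>\<^sub>E carrier (L0 M).
        (\<forall>x\<in>carrier E. \<forall>y\<in>carrier E. f (x \<oplus>\<^bsub>E\<^esub> y) = f x \<oplus>\<^bsub>L0 M\<^esub> f y) \<and>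
        (\<forall>\<xi>\<in>carrier (L0 M). \<forall>x\<in>carrier E. f (\<xi> \<odot>\<^bsub>E\<^esub> x) = \<xi> \<otimes>\<^bsub>L0 M\<^esub> f x)}"

definition conj_eps_lambda ::
    "'w measure \<Rightarrow> (('w \<Rightarrow> 'k::{real_normed_field, euclidean_space}) set, 'e, 'm) module_scheme
      \<Rightarrow> ('e \<Rightarrow> ('w \<Rightarrow> real) set) set \<Rightarrow> ('e \<Rightarrow> ('w \<Rightarrow> 'k) set) set" where
  "conj_eps_lambda M E P =
     {f \<in> L0_hom M E.
        continuous_map (eps_lambda_topology M E P) (eps_lambda_topology M (L0 M) {L0_abs M}) f}"

definition conj_L0_convex ::
    "'w measure \<Rightarrow> (('w \<Rightarrow> 'k::{real_normed_field, euclidean_space}) set, 'e, 'm) module_scheme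
      \<Rightarrow> ('e \<Rightarrow> ('w \<Rightarrow> real) set) set \<Rightarrow> ('e \<Rightarrow> ('w \<Rightarrow> 'k) set) set" where
  "conj_L0_convex M E P =
     {f \<in> L0_hom M E.
        continuous_map (L0_convex_topology M E P) (L0_convex_topology M (L0 M) {L0_abs M}) f}"

definition hom_smult ::
    "'w measure \<Rightarrow> ('e, 'm) ring_scheme \<Rightarrow> ('w \<Rightarrow> 'k::{real_normed_field, euclidean_space}) set
      \<Rightarrow> ('e \<Rightarrow> ('w \<Rightarrow> 'k) set) \<Rightarrow> 'e \<Rightarrow> ('w \<Rightarrow> 'k) set" where
  "hom_smult M E \<xi> f = (\<lambda>x\<in>carrier E. \<xi> \<otimes>\<^bsub>L0 M\<^esub> f x)"

text \<open>
  The countable concatenation hull of \<open>G\<close> in \<open>X\<close>: the concatenation of \<open>(g n)\<close> along the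
  partition \<open>(A n)\<close> is the element \<open>f\<close> of \<open>X\<close> that agrees with \<open>g n\<close> on each \<open>A n\<close>.
\<close>

definition cc_hull ::
    "'w measure \<Rightarrow> ('e, 'm) ring_scheme \<Rightarrow> ('e \<Rightarrow> ('w \<Rightarrow> 'k::{real_normed_field, euclidean_space}) set) set
      \<Rightarrow> ('e \<Rightarrow> ('w \<Rightarrow> 'k) set) set \<Rightarrow> ('e \<Rightarrow> ('w \<Rightarrow> 'k) set) set" where
  "cc_hull M E X G =
     {f \<in> X. \<exists>A g. countable_partition M A \<and> range g \<subseteq> G \<and>
        (\<forall>n. hom_smult M E (L0_ind M (A n)) f = hom_smult M E (L0_ind M (A n)) (g n))}"


section \<open>Basic facts\<close>

lemma equiv_ae_eq: "equiv (borel_measurable M) (ae_eq M)"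
  unfolding ae_eq_def
  by (rule equivI) (auto simp: refl_on_def intro!: symI transI elim: eventually_elim2 AE_mp)

lemma L0_class_in [simp, intro]: "f \<in> borel_measurable M \<Longrightarrow> L0_class M f \<in> carrier (L0 M)"
  by (auto simp: L0_def L0_class_def quotient_def)

lemma L0_class_eq_iff:
  "f \<in> borel_measurable M \<Longrightarrow> g \<in> borel_measurable M \<Longrightarrow>
     L0_class M f = L0_class M g \<longleftrightarrow> (AE w in M. f w = g w)"
  unfolding L0_class_def using eq_equiv_class_iff[OF equiv_ae_eq, of f M g]
  by (auto simp: ae_eq_def)

lemma L0_rep_in: "\<xi> \<in> carrier (L0 M) \<Longrightarrow> L0_rep \<xi> \<in> \<xi>"
  unfolding L0_rep_def L0_def
  by (metis equiv_ae_eq ex_in_conv in_quotient_imp_non_empty partial_object.select_convs(1) some_in_eq)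

lemma L0_rep_measurable [simp, measurable_dest]:
  "\<xi> \<in> carrier (L0 M) \<Longrightarrow> L0_rep \<xi> \<in> borel_measurable M"
  using L0_rep_in[of \<xi> M] by (auto simp: L0_def quotient_def ae_eq_def)

lemma L0_class_rep [simp]: "\<xi> \<in> carrier (L0 M) \<Longrightarrow> L0_class M (L0_rep \<xi>) = \<xi>"
proof -
  assume \<xi>: "\<xi> \<in> carrier (L0 M)"
  then obtain f where f: "\<xi> = ae_eq M `` {f}"
    by (auto simp: L0_def elim: quotientE)
  with L0_rep_in[OF \<xi>] have "(f, L0_rep \<xi>) \<in> ae_eq M" by simp
  from equiv_class_eq[OF equiv_ae_eq this] show ?thesis
    by (simp add: L0_class_def f)
qed

lemma AE_L0_rep_class:
  fixes f :: "'w \<Rightarrow> 'k::{real_normed_field, euclidean_space}"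
  assumes "f \<in> borel_measurable M"
  shows "AE w in M. L0_rep (L0_class M f) w = f w"
  using L0_class_eq_iff[of "L0_rep (L0_class M f)" M f] assms by simp

lemma L0_eqI:
  "\<xi> \<in> carrier (L0 M) \<Longrightarrow> \<eta> \<in> carrier (L0 M) \<Longrightarrow> AE w in M. L0_rep \<xi> w = L0_rep \<eta> w \<Longrightarrow> \<xi> = \<eta>"
  using L0_class_eq_iff[of "L0_rep \<xi>" M "L0_rep \<eta>"] by simp

lemma L0_simps [simp]:
  "\<one>\<^bsub>L0 M\<^esub> = L0_class M (\<lambda>_. 1)"
  "\<zero>\<^bsub>L0 M\<^esub> = L0_class M (\<lambda>_. 0)"
  "\<xi> \<otimes>\<^bsub>L0 M\<^esub> \<eta> = L0_class M (\<lambda>w. L0_rep \<xi> w * L0_rep \<eta> w)"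
  "\<xi> \<oplus>\<^bsub>L0 M\<^esub> \<eta> = L0_class M (\<lambda>w. L0_rep \<xi> w + L0_rep \<eta> w)"
  by (simp_all add: L0_def)

lemma L0_order_simps [simp]:
  "carrier (L0_order M) = carrier (L0 M)"
  "\<xi> \<sqsubseteq>\<^bsub>L0_order M\<^esub> \<eta> \<longleftrightarrow> (AE w in M. L0_rep \<xi> w \<le> L0_rep \<eta> w)"
  "\<xi> .=\<^bsub>L0_order M\<^esub> \<eta> \<longleftrightarrow> \<xi> = \<eta>"
  by (simp_all add: L0_order_def)

lemma L0_cring: "cring (L0 M :: ('w \<Rightarrow> 'k::{real_normed_field, euclidean_space}) set ring)"
  (is "cring ?R")
proof (rule cringI)
  note [intro!] = borel_measurable_add borel_measurable_times borel_measurable_uminus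
  show "abelian_group ?R"
  proof (rule abelian_groupI)
    fix x y z :: "('w \<Rightarrow> 'k) set" assume xyz: "x \<in> carrier (L0 M)" "y \<in> carrier (L0 M)" "z \<in> carrier (L0 M)"
    let ?a = "\<lambda>u v. L0_class M (\<lambda>w. L0_rep u w + L0_rep v w)"
    have "AE w in M. L0_rep (?a x y) w = L0_rep x w + L0_rep y w"
      "AE w in M. L0_rep (?a y z) w = L0_rep y w + L0_rep z w"
      using xyz by (auto intro!: AE_L0_rep_class)
    then have "AE w in M. L0_rep (?a x y) w + L0_rep z w = L0_rep x w + L0_rep (?a y z) w"
      by eventually_elim simp
    then show "x \<oplus>\<^bsub>L0 M\<^esub> y \<oplus>\<^bsub>L0 M\<^esub> z = x \<oplus>\<^bsub>L0 M\<^esub> (y \<oplus>\<^bsub>L0 M\<^esub> z)"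
      using xyz by (simp, subst L0_class_eq_iff) auto
  next
    fix x :: "('w \<Rightarrow> 'k) set" assume x: "x \<in> carrier (L0 M)"
    have "AE w in M. L0_rep (L0_class M (\<lambda>_. 0)) w + L0_rep x w = L0_rep x w"
      using AE_L0_rep_class[OF borel_measurable_const[of 0 M]] by eventually_elim auto
    then have "L0_class M (\<lambda>w. L0_rep (L0_class M (\<lambda>_. 0)) w + L0_rep x w) = L0_class M (L0_rep x)"
      using x by (subst L0_class_eq_iff) auto
    then show "\<zero>\<^bsub>L0 M\<^esub> \<oplus>\<^bsub>L0 M\<^esub> x = x"
      using x by simp
    have "AE w in M. L0_rep (L0_class M (\<lambda>w. - L0_rep x w)) w + L0_rep x w = 0"
      using AE_L0_rep_class[of "\<lambda>w. - L0_rep x w" M] x by (auto elim: eventually_mono)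
    then have "L0_class M (\<lambda>w. L0_rep (L0_class M (\<lambda>w. - L0_rep x w)) w + L0_rep x w) = L0_class M (\<lambda>_. 0)"
      using x by (subst L0_class_eq_iff) auto
    then show "\<exists>y\<in>carrier (L0 M). y \<oplus>\<^bsub>L0 M\<^esub> x = \<zero>\<^bsub>L0 M\<^esub>"
      using x by (intro bexI[of _ "L0_class M (\<lambda>w. - L0_rep x w)"]) auto
  qed (auto simp: add.commute)
  show "comm_monoid ?R"
  proof (rule comm_monoidI)
    fix x y z :: "('w \<Rightarrow> 'k) set" assume xyz: "x \<in> carrier (L0 M)" "y \<in> carrier (L0 M)" "z \<in> carrier (L0 M)"
    let ?a = "\<lambda>u v. L0_class M (\<lambda>w. L0_rep u w * L0_rep v w)"
    have "AE w in M. L0_rep (?a x y) w = L0_rep x w * L0_rep y w"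
      "AE w in M. L0_rep (?a y z) w = L0_rep y w * L0_rep z w"
      using xyz by (auto intro!: AE_L0_rep_class)
    then have "AE w in M. L0_rep (?a x y) w * L0_rep z w = L0_rep x w * L0_rep (?a y z) w"
      by eventually_elim simp
    then show "x \<otimes>\<^bsub>L0 M\<^esub> y \<otimes>\<^bsub>L0 M\<^esub> z = x \<otimes>\<^bsub>L0 M\<^esub> (y \<otimes>\<^bsub>L0 M\<^esub> z)"
      using xyz by (simp, subst L0_class_eq_iff) auto
  next
    fix x :: "('w \<Rightarrow> 'k) set" assume x: "x \<in> carrier (L0 M)"
    have "AE w in M. L0_rep (L0_class M (\<lambda>_. 1)) w * L0_rep x w = L0_rep x w"
      using AE_L0_rep_class[OF borel_measurable_const[of 1 M]] by eventually_elim auto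
    then have "L0_class M (\<lambda>w. L0_rep (L0_class M (\<lambda>_. 1)) w * L0_rep x w) = L0_class M (L0_rep x)"
      using x by (subst L0_class_eq_iff) auto
    then show "\<one>\<^bsub>L0 M\<^esub> \<otimes>\<^bsub>L0 M\<^esub> x = x"
      using x by simp
  qed (auto simp: mult.commute)
  fix x y z :: "('w \<Rightarrow> 'k) set" assume xyz: "x \<in> carrier (L0 M)" "y \<in> carrier (L0 M)" "z \<in> carrier (L0 M)"
  let ?a = "\<lambda>u v. L0_class M (\<lambda>w. L0_rep u w + L0_rep v w)"
  let ?m = "\<lambda>u v. L0_class M (\<lambda>w. L0_rep u w * L0_rep v w)"
  have "AE w in M. L0_rep (?a x y) w = L0_rep x w + L0_rep y w"
    "AE w in M. L0_rep (?m x z) w = L0_rep x w * L0_rep z w"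
    "AE w in M. L0_rep (?m y z) w = L0_rep y w * L0_rep z w"
    using xyz by (auto intro!: AE_L0_rep_class)
  then have "AE w in M. L0_rep (?a x y) w * L0_rep z w = L0_rep (?m x z) w + L0_rep (?m y z) w"
    by eventually_elim (simp add: ring_distribs)
  then show "(x \<oplus>\<^bsub>L0 M\<^esub> y) \<otimes>\<^bsub>L0 M\<^esub> z = x \<otimes>\<^bsub>L0 M\<^esub> z \<oplus>\<^bsub>L0 M\<^esub> y \<otimes>\<^bsub>L0 M\<^esub> z"
    using xyz by (simp, subst L0_class_eq_iff) auto
qed

lemma L0_partial_order: "partial_order (L0_order M)"
proof
  fix x y z assume xyz: "x \<in> carrier (L0_order M)" "y \<in> carrier (L0_order M)" "z \<in> carrier (L0_order M)"
  assume "x \<sqsubseteq>\<^bsub>L0_order M\<^esub> y" "y \<sqsubseteq>\<^bsub>L0_order M\<^esub> z"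
  then have "AE w in M. L0_rep x w \<le> L0_rep y w" "AE w in M. L0_rep y w \<le> L0_rep z w"
    by simp_all
  then have "AE w in M. L0_rep x w \<le> L0_rep z w"
    by eventually_elim simp
  then show "x \<sqsubseteq>\<^bsub>L0_order M\<^esub> z" by simp
next
  fix x y assume xy: "x \<in> carrier (L0_order M)" "y \<in> carrier (L0_order M)"
  assume "x \<sqsubseteq>\<^bsub>L0_order M\<^esub> y" "y \<sqsubseteq>\<^bsub>L0_order M\<^esub> x"
  then have "AE w in M. L0_rep x w \<le> L0_rep y w" "AE w in M. L0_rep y w \<le> L0_rep x w"
    by simp_all
  then have "AE w in M. L0_rep x w = L0_rep y w"
    by eventually_elim simp
  then show "x .=\<^bsub>L0_order M\<^esub> y" using xy by (simp add: L0_eqI)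
qed (auto simp: fun_eq_iff L0_order_def)

lemma AE_L0_rep_fin_norm:
  assumes "finite Q" "Q \<noteq> {}" "\<And>p. p \<in> Q \<Longrightarrow> p x \<in> carrier (L0 M)"
  shows "fin_norm M Q x \<in> carrier (L0 M)"
    and "AE w in M. L0_rep (fin_norm M Q x) w = Max ((\<lambda>p. L0_rep (p x) w) ` Q)"
proof -
  interpret partial_order "L0_order M" by (rule L0_partial_order)
  let ?m = "\<lambda>w. Max ((\<lambda>p. L0_rep (p x) w) ` Q)"
  have [measurable]: "?m \<in> borel_measurable M"
    using assms by (intro borel_measurable_Max) auto
  note rep = AE_L0_rep_class[OF this]
  have "least (L0_order M) (L0_class M ?m) (Upper (L0_order M) ((\<lambda>p. p x) ` Q))"
  proof (rule least_UpperI)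
    fix \<xi> assume "\<xi> \<in> (\<lambda>p. p x) ` Q"
    then obtain p where p: "p \<in> Q" "\<xi> = p x" by blast
    from rep show "\<xi> \<sqsubseteq>\<^bsub>L0_order M\<^esub> L0_class M ?m"
      using assms p by (auto elim!: eventually_mono)
  next
    fix \<eta> assume "\<eta> \<in> Upper (L0_order M) ((\<lambda>p. p x) ` Q)"
    then have "\<forall>p\<in>Q. AE w in M. L0_rep (p x) w \<le> L0_rep \<eta> w"
      using assms(3) by (auto simp: Upper_def)
    then have "AE w in M. \<forall>p\<in>Q. L0_rep (p x) w \<le> L0_rep \<eta> w"
      using assms(1) by (simp add: AE_finite_all)
    with rep have "AE w in M. L0_rep (L0_class M ?m) w \<le> L0_rep \<eta> w"
      by eventually_elim (use assms in auto)
    then show "L0_class M ?m \<sqsubseteq>\<^bsub>L0_order M\<^esub> \<eta>" by simp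
  qed (use assms in auto)
  then have "fin_norm M Q x = L0_class M ?m"
    unfolding fin_norm_def Lattice.sup_def by (metis (mono_tags, lifting) least_unique someI_ex)
  then show "fin_norm M Q x \<in> carrier (L0 M)" "AE w in M. L0_rep (fin_norm M Q x) w = ?m w"
    using rep by auto
qed

lemma AE_fin_norm_mono:
  assumes "finite Q'" "Q \<subseteq> Q'" "Q \<noteq> {}" "\<And>p. p \<in> Q' \<Longrightarrow> p x \<in> carrier (L0 M)"
  shows "AE w in M. L0_rep (fin_norm M Q x) w \<le> L0_rep (fin_norm M Q' x) w"
proof -
  have "AE w in M. L0_rep (fin_norm M Q x) w = Max ((\<lambda>p. L0_rep (p x) w) ` Q)"
    using assms by (intro AE_L0_rep_fin_norm) (auto intro: finite_subset)
  moreover have "AE w in M. L0_rep (fin_norm M Q' x) w = Max ((\<lambda>p. L0_rep (p x) w) ` Q')"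
    using assms by (intro AE_L0_rep_fin_norm) auto
  ultimately show ?thesis
    by eventually_elim (use assms in \<open>auto intro!: Max_mono\<close>)
qed

lemma openin_translation_topology:
  assumes "\<And>N N'. N \<in> B \<Longrightarrow> N' \<in> B \<Longrightarrow> \<exists>N''\<in>B. N'' \<subseteq> N \<inter> N'"
  shows "openin (translation_topology E B) U \<longleftrightarrow>
           U \<subseteq> carrier E \<and> (\<forall>x\<in>U. \<exists>N\<in>B. (\<lambda>y. x \<oplus>\<^bsub>E\<^esub> y) ` N \<subseteq> U)"
proof -
  have "istopology (\<lambda>U. U \<subseteq> carrier E \<and> (\<forall>x\<in>U. \<exists>N\<in>B. (\<lambda>y. x \<oplus>\<^bsub>E\<^esub> y) ` N \<subseteq> U))"
    unfolding istopology_def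
  proof (intro conjI allI impI ballI)
    fix S T x
    assume S: "S \<subseteq> carrier E \<and> (\<forall>x\<in>S. \<exists>N\<in>B. (\<lambda>y. x \<oplus>\<^bsub>E\<^esub> y) ` N \<subseteq> S)"
      and T: "T \<subseteq> carrier E \<and> (\<forall>x\<in>T. \<exists>N\<in>B. (\<lambda>y. x \<oplus>\<^bsub>E\<^esub> y) ` N \<subseteq> T)"
      and x: "x \<in> S \<inter> T"
    then obtain N N' where "N \<in> B" "(\<lambda>y. x \<oplus>\<^bsub>E\<^esub> y) ` N \<subseteq> S" "N' \<in> B" "(\<lambda>y. x \<oplus>\<^bsub>E\<^esub> y) ` N' \<subseteq> T"
      by blast
    moreover obtain N'' where "N'' \<in> B" "N'' \<subseteq> N \<inter> N'"
      using assms[OF \<open>N \<in> B\<close> \<open>N' \<in> B\<close>] by blast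
    ultimately have "N'' \<in> B \<and> (\<lambda>y. x \<oplus>\<^bsub>E\<^esub> y) ` N'' \<subseteq> S \<inter> T"
      by (auto simp: image_subset_iff)
    then show "\<exists>N\<in>B. (\<lambda>y. x \<oplus>\<^bsub>E\<^esub> y) ` N \<subseteq> S \<inter> T" by blast
  next
    fix \<K> x
    assume *: "\<forall>K\<in>\<K>. K \<subseteq> carrier E \<and> (\<forall>x\<in>K. \<exists>N\<in>B. (\<lambda>y. x \<oplus>\<^bsub>E\<^esub> y) ` N \<subseteq> K)" and "x \<in> \<Union>\<K>"
    then obtain K where "K \<in> \<K>" "x \<in> K" by blast
    with * obtain N where "N \<in> B" "(\<lambda>y. x \<oplus>\<^bsub>E\<^esub> y) ` N \<subseteq> K" by blast
    with \<open>K \<in> \<K>\<close> show "\<exists>N\<in>B. (\<lambda>y. x \<oplus>\<^bsub>E\<^esub> y) ` N \<subseteq> \<Union>\<K>" by blast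
  qed blast+
  then show ?thesis
    unfolding translation_topology_def by (simp add: topology_inverse')
qed

lemma L0_convex_base_directed:
  assumes P: "\<And>p x. p \<in> P \<Longrightarrow> x \<in> carrier E \<Longrightarrow> p x \<in> carrier (L0 M)"
    and "N \<in> L0_convex_base M E P" "N' \<in> L0_convex_base M E P"
  shows "\<exists>N''\<in>L0_convex_base M E P. N'' \<subseteq> N \<inter> N'"
proof -
  from assms obtain Q \<epsilon> Q' \<epsilon>'
    where N: "N = {x \<in> carrier E. fin_norm M Q x \<sqsubseteq>\<^bsub>L0_order M\<^esub> \<epsilon>}"
      and N': "N' = {x \<in> carrier E. fin_norm M Q' x \<sqsubseteq>\<^bsub>L0_order M\<^esub> \<epsilon>'}"
      and Q: "Q \<subseteq> P" "finite Q" "Q \<noteq> {}" "\<epsilon> \<in> L0_pos M"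
      and Q': "Q' \<subseteq> P" "finite Q'" "Q' \<noteq> {}" "\<epsilon>' \<in> L0_pos M"
    unfolding L0_convex_base_def by blast
  let ?Q = "Q \<union> Q'" and ?\<epsilon> = "L0_class M (\<lambda>w. min (L0_rep \<epsilon> w) (L0_rep \<epsilon>' w))"
  have [simp]: "\<epsilon> \<in> carrier (L0 M)" "\<epsilon>' \<in> carrier (L0 M)"
    and pos: "AE w in M. 0 < L0_rep \<epsilon> w" "AE w in M. 0 < L0_rep \<epsilon>' w"
    using Q Q' by (auto simp: L0_pos_def)
  have rep: "AE w in M. L0_rep ?\<epsilon> w = min (L0_rep \<epsilon> w) (L0_rep \<epsilon>' w)"
    by (intro AE_L0_rep_class borel_measurable_min) auto
  with pos have "AE w in M. 0 < L0_rep ?\<epsilon> w"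
    by eventually_elim simp
  then have "?\<epsilon> \<in> L0_pos M"
    by (auto simp: L0_pos_def intro!: L0_class_in borel_measurable_min)
  then have "{x \<in> carrier E. fin_norm M ?Q x \<sqsubseteq>\<^bsub>L0_order M\<^esub> ?\<epsilon>} \<in> L0_convex_base M E P"
    unfolding L0_convex_base_def using Q Q'
    by (intro CollectI exI[of _ ?Q] exI[of _ ?\<epsilon>]) auto
  moreover have "x \<in> N \<inter> N'" if "x \<in> carrier E" "fin_norm M ?Q x \<sqsubseteq>\<^bsub>L0_order M\<^esub> ?\<epsilon>" for x
  proof -
    have le: "AE w in M. L0_rep (fin_norm M ?Q x) w \<le> L0_rep ?\<epsilon> w" using that by simp
    have m: "AE w in M. L0_rep (fin_norm M Q x) w \<le> L0_rep (fin_norm M ?Q x) w"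
      "AE w in M. L0_rep (fin_norm M Q' x) w \<le> L0_rep (fin_norm M ?Q x) w"
      using Q Q' subsetD[OF Q(1), THEN P[OF _ that(1)]] subsetD[OF Q'(1), THEN P[OF _ that(1)]]
      by (auto intro!: AE_fin_norm_mono simp del: L0_order_simps)
    have "AE w in M. L0_rep (fin_norm M Q x) w \<le> L0_rep \<epsilon> w"
      using le m(1) rep by eventually_elim simp
    moreover have "AE w in M. L0_rep (fin_norm M Q' x) w \<le> L0_rep \<epsilon>' w"
      using le m(2) rep by eventually_elim simp
    ultimately show ?thesis using that by (simp add: N N')
  qed
  ultimately show ?thesis
    by (intro bexI[of _ "{x \<in> carrier E. fin_norm M ?Q x \<sqsubseteq>\<^bsub>L0_order M\<^esub> ?\<epsilon>}"])
       (auto simp del: L0_order_simps)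
qed

lemma eps_lambda_base_directed:
  assumes "prob_space M" and P: "\<And>p x. p \<in> P \<Longrightarrow> x \<in> carrier E \<Longrightarrow> p x \<in> carrier (L0 M)"
    and "N \<in> eps_lambda_base M E P" "N' \<in> eps_lambda_base M E P"
  shows "\<exists>N''\<in>eps_lambda_base M E P. N'' \<subseteq> N \<inter> N'"
proof -
  interpret prob_space M by fact
  let ?B = "\<lambda>Q \<epsilon> \<delta>. {x \<in> carrier E. 1 - \<delta> < prob {w \<in> space M. L0_rep (fin_norm M Q x) w < \<epsilon>}}"
  from assms obtain Q \<epsilon> \<delta> Q' \<epsilon>' \<delta>'
    where N: "N = ?B Q \<epsilon> \<delta>" and N': "N' = ?B Q' \<epsilon>' \<delta>'"
      and Q: "Q \<subseteq> P" "finite Q" "Q \<noteq> {}" "0 < \<epsilon>" "0 < \<delta>" "\<delta> < 1"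
      and Q': "Q' \<subseteq> P" "finite Q'" "Q' \<noteq> {}" "0 < \<epsilon>'" "0 < \<delta>'" "\<delta>' < 1"
    unfolding eps_lambda_base_def by blast
  let ?Q = "Q \<union> Q'" and ?\<epsilon> = "min \<epsilon> \<epsilon>'" and ?\<delta> = "min \<delta> \<delta>'"
  have mono: "?B R' \<gamma>' \<beta>' \<subseteq> ?B R \<gamma> \<beta>"
    if R: "R \<subseteq> R'" "R' \<subseteq> P" "finite R'" "R \<noteq> {}" "\<gamma>' \<le> \<gamma>" "\<beta>' \<le> \<beta>" for R R' \<gamma> \<gamma>' \<beta> \<beta>'
  proof
    fix x assume x: "x \<in> ?B R' \<gamma>' \<beta>'"
    have [measurable]: "L0_rep (fin_norm M R x) \<in> borel_measurable M"
      "L0_rep (fin_norm M R' x) \<in> borel_measurable M"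
      using R x P by (auto intro!: L0_rep_measurable AE_L0_rep_fin_norm(1) intro: finite_subset)
    have "AE w in M. L0_rep (fin_norm M R x) w \<le> L0_rep (fin_norm M R' x) w"
      using R x P by (intro AE_fin_norm_mono) auto
    then have "prob {w \<in> space M. L0_rep (fin_norm M R' x) w < \<gamma>'}
        \<le> prob {w \<in> space M. L0_rep (fin_norm M R x) w < \<gamma>}"
      by (intro finite_measure_mono_AE) (use R in \<open>auto elim!: eventually_mono\<close>)
    with x R show "x \<in> ?B R \<gamma> \<beta>" by auto
  qed
  have "?B ?Q ?\<epsilon> ?\<delta> \<in> eps_lambda_base M E P"
    unfolding eps_lambda_base_def using Q Q'
    by (intro CollectI exI[of _ ?Q] exI[of _ ?\<epsilon>] exI[of _ ?\<delta>]) auto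
  moreover have "?B ?Q ?\<epsilon> ?\<delta> \<subseteq> N \<inter> N'"
    unfolding N N' using Q Q' by (intro Int_greatest mono) auto
  ultimately show ?thesis by blast
qed

lemma (in RLC_module) seminorm_closed:
  "p \<in> P \<Longrightarrow> x \<in> carrier E \<Longrightarrow> p x \<in> carrier (L0 M)"
  using seminorm[of p] by (auto simp: L0_seminorm_def L0_nonneg_def)

lemma (in RLC_module) openin_eps_lambda_topology:
  "openin (eps_lambda_topology M E P) U \<longleftrightarrow>
     U \<subseteq> carrier E \<and> (\<forall>x\<in>U. \<exists>N\<in>eps_lambda_base M E P. (\<lambda>y. x \<oplus>\<^bsub>E\<^esub> y) ` N \<subseteq> U)"
  unfolding eps_lambda_topology_def
  by (rule openin_translation_topology, rule eps_lambda_base_directed)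
     (auto intro: prob_space_axioms seminorm_closed)

lemma (in RLC_module) openin_L0_convex_topology:
  "openin (L0_convex_topology M E P) U \<longleftrightarrow>
     U \<subseteq> carrier E \<and> (\<forall>x\<in>U. \<exists>N\<in>L0_convex_base M E P. (\<lambda>y. x \<oplus>\<^bsub>E\<^esub> y) ` N \<subseteq> U)"
  unfolding L0_convex_topology_def
  by (rule openin_translation_topology, rule L0_convex_base_directed) (auto intro: seminorm_closed)

lemma L0_abs_closed: "\<xi> \<in> carrier (L0 M) \<Longrightarrow> L0_abs M \<xi> \<in> carrier (L0 M)"
  unfolding L0_abs_def by (intro L0_class_in measurable_compose[OF L0_rep_measurable borel_measurable_norm])

lemma (in prob_space) openin_eps_lambda_topology_L0:
  "openin (eps_lambda_topology M (L0 M) {L0_abs M}) U \<longleftrightarrow>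
     U \<subseteq> carrier (L0 M) \<and>
     (\<forall>x\<in>U. \<exists>N\<in>eps_lambda_base M (L0 M) {L0_abs M}. (\<lambda>y. x \<oplus>\<^bsub>L0 M\<^esub> y) ` N \<subseteq> U)"
  unfolding eps_lambda_topology_def
  by (rule openin_translation_topology, rule eps_lambda_base_directed)
     (auto intro: prob_space_axioms L0_abs_closed)

lemma openin_L0_convex_topology_L0:
  "openin (L0_convex_topology M (L0 M) {L0_abs M}) U \<longleftrightarrow>
     U \<subseteq> carrier (L0 M) \<and>
     (\<forall>x\<in>U. \<exists>N\<in>L0_convex_base M (L0 M) {L0_abs M}. (\<lambda>y. x \<oplus>\<^bsub>L0 M\<^esub> y) ` N \<subseteq> U)"
  unfolding L0_convex_topology_def
  by (rule openin_translation_topology, rule L0_convex_base_directed) (auto intro: L0_abs_closed)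

end

theory Submission
  imports Defs
begin

text \<open>
  Continuity of \<open>f\<close> in the \<open>(\<epsilon>,\<lambda>)\<close>-topology gives, for each \<open>n\<close>, a finite \<open>Q\<close> and a
  constant \<open>e > 0\<close> such that \<open>\<parallel>x\<parallel>\<^sub>Q \<le> e\<close> forces \<open>|f x| \<ge> 1\<close> to have probability at most
  \<open>1/(n + 2)\<close>.  Gluing \<open>x\<close> on \<open>A\<close> with \<open>y\<close> off \<open>A\<close> shows that the events \<open>{|f x| \<ge> 1}\<close> are
  directed up to null sets, so that their essential union \<open>C\<close> still has probability at most
  \<open>1/(n + 2)\<close>.  Off \<open>C\<close>, scaling by elements of \<open>L0\<close> yields \<open>|f x| \<le> \<parallel>x\<parallel>\<^sub>Q / e\<close> for all \<open>x\<close>, hence the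
  restriction of \<open>f\<close> to the complement of \<open>C\<close> is continuous in the locally \<open>L0\<close>-convex
  topology.  These complements exhaust \<open>\<Omega>\<close> up to a null set; made disjoint, they are the required partition.
\<close>

section \<open>Essential unions of directed families of events\<close>

text \<open>An uncountable union may fail to be measurable, so \<open>C\<close> is the union of a
  sequence whose probabilities approach the supremum \<open>s\<close>. A member of
  \<open>\<C>\<close> exceeding \<open>C\<close> by positive probability would push some member of
  \<open>\<C>\<close> above \<open>s\<close>.\<close>

lemma (in prob_space) ess_union_of_directed:
  assumes sets: "\<C> \<subseteq> events" and "{} \<in> \<C>"
    and Un: "\<And>A B. A \<in> \<C> \<Longrightarrow> B \<in> \<C> \<Longrightarrow> A \<union> B \<in> \<C>"
    and le: "\<And>A. A \<in> \<C> \<Longrightarrow> prob A \<le> c"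
  shows "\<exists>C\<in>events. prob C \<le> c \<and> (\<forall>A\<in>\<C>. AE w in M. w \<in> A \<longrightarrow> w \<in> C)"
proof -
  define s where "s = Sup (prob ` \<C>)"
  have bdd: "bdd_above (prob ` \<C>)"
    using le by (auto intro: bdd_aboveI2)
  have le_s: "prob A \<le> s" if "A \<in> \<C>" for A
    unfolding s_def using bdd that by (intro cSup_upper) auto
  have "s \<le> c"
    unfolding s_def using \<open>{} \<in> \<C>\<close> le by (intro cSup_least) auto
  have "\<exists>A\<in>\<C>. s - 1 / Suc n < prob A" for n
    using less_cSup_iff[OF _ bdd, of "s - 1 / Suc n"] \<open>{} \<in> \<C>\<close> by (auto simp: s_def)
  then obtain A where A: "\<And>n. A n \<in> \<C>" "\<And>n. s - 1 / Suc n < prob (A n)"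
    by metis
  define D where "D n = (\<Union>i\<le>n. A i)" for n
  define C where "C = (\<Union>n. D n)"
  have D: "D n \<in> \<C>" for n
    by (induction n) (auto simp: D_def atMost_Suc intro!: Un A)
  have [measurable]: "D n \<in> events" "C \<in> events" for n
    using D sets by (auto simp: C_def)
  have inc: "incseq D"
    by (fastforce simp: D_def incseq_def)
  \<comment> \<open>\<open>B \<union> C\<close> need not lie in \<open>\<C>\<close>, but it is the
    increasing limit of the sets \<open>B \<union> D n\<close>, which do.\<close>
  have le_sC: "prob (B \<union> C) \<le> s" if B: "B \<in> \<C>" for B
  proof -
    have "(\<lambda>n. prob (B \<union> D n)) \<longlonglongrightarrow> prob (\<Union>n. B \<union> D n)"
    proof (rule finite_Lim_measure_incseq)
      show "range (\<lambda>n. B \<union> D n) \<subseteq> events"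
        using B sets by auto
      show "incseq (\<lambda>n. B \<union> D n)"
        using inc by (fastforce simp: incseq_def)
    qed
    then show ?thesis
      using Un[OF B D] le_s by (intro LIMSEQ_le_const2[of "\<lambda>n. prob (B \<union> D n)"]) (auto simp: C_def)
  qed
  have "s \<le> prob C"
  proof (rule field_le_epsilon)
    fix e :: real assume "0 < e"
    then obtain n where "1 / Suc n < e"
      using nat_approx_posE by blast
    moreover have "prob (A n) \<le> prob C"
    proof (rule finite_measure_mono)
      show "A n \<subseteq> C" by (auto simp: C_def D_def)
    qed measurable
    ultimately show "s \<le> prob C + e"
      using A(2)[of n] by linarith
  qed
  have "AE w in M. w \<in> B \<longrightarrow> w \<in> C" if B: "B \<in> \<C>" for B
  proof -
    have [measurable]: "B \<in> events"
      using B sets by blast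
    have "prob (B - C \<union> C) = prob (B - C) + prob C"
      by (rule finite_measure_Union) auto
    then have "prob (B - C) = 0"
      using le_sC[OF B] \<open>s \<le> prob C\<close> measure_nonneg[of M "B - C"] unfolding Un_Diff_cancel2 by linarith
    then have "AE w in M. w \<notin> B - C"
      by (intro AE_not_in) (auto simp: null_sets_def emeasure_eq_measure)
    then show ?thesis by eventually_elim auto
  qed
  \<comment> \<open>At the empty set, \<open>le_sC\<close> reads
    \<open>prob C \<le> s\<close>.\<close>
  then show ?thesis
    using le_sC[OF \<open>{} \<in> \<C>\<close>] \<open>s \<le> c\<close> by (intro bexI[of _ C]) auto
qed

section \<open>Pointwise almost-everywhere rules for representatives in \<open>L0\<close>\<close>

lemma AE_L0_rep_mult:
  assumes "\<xi> \<in> carrier (L0 M)" "\<eta> \<in> carrier (L0 M)"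
  shows "AE w in M. L0_rep (\<xi> \<otimes>\<^bsub>L0 M\<^esub> \<eta>) w = L0_rep \<xi> w * L0_rep \<eta> w"
  using assms by (auto intro!: AE_L0_rep_class borel_measurable_times)

lemma AE_L0_rep_add:
  assumes "\<xi> \<in> carrier (L0 M)" "\<eta> \<in> carrier (L0 M)"
  shows "AE w in M. L0_rep (\<xi> \<oplus>\<^bsub>L0 M\<^esub> \<eta>) w = L0_rep \<xi> w + L0_rep \<eta> w"
  using assms by (auto intro!: AE_L0_rep_class borel_measurable_add)

lemma AE_L0_rep_abs:
  assumes "\<xi> \<in> carrier (L0 M)"
  shows "AE w in M. L0_rep (L0_abs M \<xi>) w = norm (L0_rep \<xi> w)"
  unfolding L0_abs_def
  by (intro AE_L0_rep_class measurable_compose[OF L0_rep_measurable borel_measurable_norm] assms)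

lemma L0_ind_closed: "A \<in> sets M \<Longrightarrow> L0_ind M A \<in> carrier (L0 M)"
  unfolding L0_ind_def by auto

lemma AE_L0_rep_ind:
  "A \<in> sets M \<Longrightarrow> AE w in M. L0_rep (L0_ind M A) w = indicator A w"
  unfolding L0_ind_def by (auto intro!: AE_L0_rep_class)

lemma AE_L0_rep_fin_norm_abs:
  assumes "\<xi> \<in> carrier (L0 M)"
  shows "AE w in M. L0_rep (fin_norm M {L0_abs M} \<xi>) w = norm (L0_rep \<xi> w)"
  using AE_L0_rep_fin_norm(2)[of "{L0_abs M}" \<xi> M] AE_L0_rep_abs[OF assms] L0_abs_closed[OF assms]
  by auto

section \<open>Pointwise rules for the seminorms and their finite suprema\<close>

context RLC_module
begin

lemma AE_seminorm_smult:
  assumes "p \<in> P" "\<xi> \<in> carrier (L0 M)" "x \<in> carrier E"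
  shows "AE w in M. L0_rep (p (\<xi> \<odot>\<^bsub>E\<^esub> x)) w = norm (L0_rep \<xi> w) * L0_rep (p x) w"
proof -
  have "p (\<xi> \<odot>\<^bsub>E\<^esub> x) = L0_abs M \<xi> \<otimes>\<^bsub>L0 M\<^esub> p x"
    using seminorm[OF assms(1)] assms by (simp add: L0_seminorm_def)
  then show ?thesis
    using AE_L0_rep_mult[OF L0_abs_closed[OF assms(2)] seminorm_closed[OF assms(1,3)]]
      AE_L0_rep_abs[OF assms(2)] by auto
qed

lemma AE_seminorm_add:
  assumes "p \<in> P" "x \<in> carrier E" "y \<in> carrier E"
  shows "AE w in M. L0_rep (p (x \<oplus>\<^bsub>E\<^esub> y)) w \<le> L0_rep (p x) w + L0_rep (p y) w"
proof -
  have "AE w in M. L0_rep (p (x \<oplus>\<^bsub>E\<^esub> y)) w \<le> L0_rep (p x \<oplus>\<^bsub>L0 M\<^esub> p y) w"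
    using seminorm[OF assms(1)] assms by (simp add: L0_seminorm_def)
  then show ?thesis
    using AE_L0_rep_add[OF seminorm_closed[OF assms(1,2)] seminorm_closed[OF assms(1,3)]]
    by eventually_elim simp
qed

lemma AE_seminorm_nonneg:
  assumes "p \<in> P" "x \<in> carrier E"
  shows "AE w in M. 0 \<le> L0_rep (p x) w"
proof -
  have "p x \<in> L0_nonneg M"
    using seminorm[OF assms(1)] assms by (auto simp: L0_seminorm_def)
  then have "AE w in M. L0_rep (L0_class M (\<lambda>_. 0 :: real)) w \<le> L0_rep (p x) w"
    by (simp add: L0_nonneg_def)
  moreover have "AE w in M. L0_rep (L0_class M (\<lambda>_. 0 :: real)) w = 0"
    by (intro AE_L0_rep_class) auto
  ultimately show ?thesis by eventually_elim simp
qed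

context
  fixes Q assumes Q: "Q \<subseteq> P" "finite Q" "Q \<noteq> {}"
begin

lemma fin_norm_closed: "x \<in> carrier E \<Longrightarrow> fin_norm M Q x \<in> carrier (L0 M)"
  using Q seminorm_closed by (intro AE_L0_rep_fin_norm(1)) auto

lemma AE_fin_norm:
  "x \<in> carrier E \<Longrightarrow> AE w in M. L0_rep (fin_norm M Q x) w = Max ((\<lambda>p. L0_rep (p x) w) ` Q)"
  using Q seminorm_closed by (intro AE_L0_rep_fin_norm(2)) auto

lemma AE_fin_norm_nonneg:
  assumes "x \<in> carrier E"
  shows "AE w in M. 0 \<le> L0_rep (fin_norm M Q x) w"
proof -
  have "AE w in M. \<forall>p\<in>Q. 0 \<le> L0_rep (p x) w"
    using AE_seminorm_nonneg assms Q by (auto simp: AE_finite_all)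
  with AE_fin_norm[OF assms] show ?thesis
    by eventually_elim (use Q in \<open>auto simp: Max_ge_iff\<close>)
qed

lemma AE_fin_norm_smult:
  assumes "\<xi> \<in> carrier (L0 M)" "x \<in> carrier E"
  shows "AE w in M. L0_rep (fin_norm M Q (\<xi> \<odot>\<^bsub>E\<^esub> x)) w = norm (L0_rep \<xi> w) * L0_rep (fin_norm M Q x) w"
proof -
  have "AE w in M. \<forall>p\<in>Q. L0_rep (p (\<xi> \<odot>\<^bsub>E\<^esub> x)) w = norm (L0_rep \<xi> w) * L0_rep (p x) w"
    using AE_seminorm_smult assms Q by (auto simp: AE_finite_all)
  with AE_fin_norm[OF assms(2)] AE_fin_norm[OF E.smult_closed[OF assms]] show ?thesis
  proof eventually_elim
    case (elim w)
    \<comment> \<open>Multiplication by a nonnegative real is monotone, hence commutes with the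
      maximum of a finite set.\<close>
    have "norm (L0_rep \<xi> w) * Max ((\<lambda>p. L0_rep (p x) w) ` Q)
        = Max ((\<lambda>t. norm (L0_rep \<xi> w) * t) ` (\<lambda>p. L0_rep (p x) w) ` Q)"
      using Q by (intro mono_Max_commute) (auto simp: mono_def mult_left_mono)
    with elim show ?case by (simp add: image_image)
  qed
qed

lemma AE_fin_norm_add:
  assumes "x \<in> carrier E" "y \<in> carrier E"
  shows "AE w in M. L0_rep (fin_norm M Q (x \<oplus>\<^bsub>E\<^esub> y)) w
           \<le> L0_rep (fin_norm M Q x) w + L0_rep (fin_norm M Q y) w"
proof -
  have "AE w in M. \<forall>p\<in>Q. L0_rep (p (x \<oplus>\<^bsub>E\<^esub> y)) w \<le> L0_rep (p x) w + L0_rep (p y) w"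
    using AE_seminorm_add assms Q by (auto simp: AE_finite_all)
  with AE_fin_norm[OF assms(1)] AE_fin_norm[OF assms(2)] AE_fin_norm[OF E.a_closed[OF assms]]
  show ?thesis
  proof eventually_elim
    case (elim w)
    have "L0_rep (p (x \<oplus>\<^bsub>E\<^esub> y)) w \<le> Max ((\<lambda>p. L0_rep (p x) w) ` Q) + Max ((\<lambda>p. L0_rep (p y) w) ` Q)"
      if "p \<in> Q" for p
      using elim(4) that Q by (intro order_trans[OF bspec[OF elim(4) that]] add_mono) auto
    with elim Q show ?case by simp
  qed
qed

end

section \<open>Module homomorphisms\<close>

lemma AE_hom_add:
  assumes "f \<in> L0_hom M E" "x \<in> carrier E" "y \<in> carrier E"
  shows "AE w in M. L0_rep (f (x \<oplus>\<^bsub>E\<^esub> y)) w = L0_rep (f x) w + L0_rep (f y) w"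
proof -
  have "f (x \<oplus>\<^bsub>E\<^esub> y) = f x \<oplus>\<^bsub>L0 M\<^esub> f y" "f x \<in> carrier (L0 M)" "f y \<in> carrier (L0 M)"
    using assms by (auto simp: L0_hom_def simp del: L0_simps)
  then show ?thesis
    using AE_L0_rep_add[of "f x" M "f y"] by (simp only: simp_thms)
qed

lemma AE_hom_smult:
  assumes "f \<in> L0_hom M E" "\<xi> \<in> carrier (L0 M)" "x \<in> carrier E"
  shows "AE w in M. L0_rep (f (\<xi> \<odot>\<^bsub>E\<^esub> x)) w = L0_rep \<xi> w * L0_rep (f x) w"
proof -
  have "f (\<xi> \<odot>\<^bsub>E\<^esub> x) = \<xi> \<otimes>\<^bsub>L0 M\<^esub> f x" "f x \<in> carrier (L0 M)"
    using assms by (auto simp: L0_hom_def simp del: L0_simps)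
  then show ?thesis
    using AE_L0_rep_mult[OF assms(2), of "f x"] by (simp only: simp_thms)
qed

lemma hom_closed: "f \<in> L0_hom M E \<Longrightarrow> x \<in> carrier E \<Longrightarrow> f x \<in> carrier (L0 M)"
  by (auto simp: L0_hom_def)

text \<open>Compatibility with scalars rests on the commutativity of \<open>L0 M\<close>. With
  indicator classes as \<open>\<xi>\<close>, this makes the pieces of \<open>f\<close> on a
  partition homomorphisms again.\<close>

lemma hom_smult_in_L0_hom:
  assumes f: "f \<in> L0_hom M E" and \<xi>: "\<xi> \<in> carrier (L0 M)"
  shows "hom_smult M E \<xi> f \<in> L0_hom M E"
proof -
  have ad: "f (x \<oplus>\<^bsub>E\<^esub> y) = f x \<oplus>\<^bsub>L0 M\<^esub> f y" if "x \<in> carrier E" "y \<in> carrier E" for x y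
    using f that by (auto simp: L0_hom_def simp del: L0_simps)
  have sm: "f (\<eta> \<odot>\<^bsub>E\<^esub> x) = \<eta> \<otimes>\<^bsub>L0 M\<^esub> f x" if "x \<in> carrier E" "\<eta> \<in> carrier (L0 M)" for x \<eta>
    using f that by (auto simp: L0_hom_def simp del: L0_simps)
  show ?thesis
    using \<xi> hom_closed[OF f] unfolding L0_hom_def hom_smult_def
    by (auto simp: ad sm E.r_distr E.m_lcomm simp del: L0_simps)
qed

section \<open>The two topologies and criteria for openness and continuity\<close>

text \<open>Over an empty family every class is an upper bound, including that of the constant -1,
  so the class of 0 is not least; this contradicts separation at the null element.\<close>

lemma nonempty_seminorms: "P \<noteq> {}"
proof
  assume "P = {}"
  then have "least (L0_order M) \<zero>\<^bsub>L0 M\<^esub> (carrier (L0 M))"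
    using separating[OF E.zero_closed] by (simp add: Upper_def)
  then have "\<zero>\<^bsub>L0 M\<^esub> \<sqsubseteq>\<^bsub>L0_order M\<^esub> L0_class M (\<lambda>_. -1)"
    by (auto simp: least_def simp del: L0_order_simps(2))
  then have "AE w in M. L0_rep (L0_class M (\<lambda>_. 0 :: real)) w \<le> L0_rep (L0_class M (\<lambda>_. - 1 :: real)) w"
    by simp
  moreover have "AE w in M. L0_rep (L0_class M (\<lambda>_. c :: real)) w = c" for c
    by (intro AE_L0_rep_class) auto
  from this[of 0] this[of "-1"] have "AE w in M. L0_rep (L0_class M (\<lambda>_. 0 :: real)) w = 0"
    "AE w in M. L0_rep (L0_class M (\<lambda>_. - 1 :: real)) w = - 1" .
  ultimately have "AE w in M. False"
    by eventually_elim simp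
  then show False by simp
qed

text \<open>Openness of the whole carrier asks for some basic neighbourhood at each point, so the
  base must be nonempty.\<close>

lemma topspace_eps_lambda: "topspace (eps_lambda_topology M E P) = carrier E"
proof -
  obtain p where "p \<in> P" using nonempty_seminorms by blast
  then have "eps_lambda_base M E P \<noteq> {}"
    unfolding eps_lambda_base_def
    by (auto intro!: exI[of _ "{p}"] exI[of _ "1::real"] exI[of _ "1/2::real"])
  then have "openin (eps_lambda_topology M E P) (carrier E)"
    unfolding openin_eps_lambda_topology
  proof (intro conjI ballI)
    fix x assume x: "x \<in> carrier E"
    obtain N where N: "N \<in> eps_lambda_base M E P"
      using \<open>eps_lambda_base M E P \<noteq> {}\<close> by blast
    then have "N \<subseteq> carrier E"
      unfolding eps_lambda_base_def by blast
    then have "(\<lambda>y. x \<oplus>\<^bsub>E\<^esub> y) ` N \<subseteq> carrier E"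
      using x E.a_closed by blast
    with N show "\<exists>N\<in>eps_lambda_base M E P. (\<lambda>y. x \<oplus>\<^bsub>E\<^esub> y) ` N \<subseteq> carrier E" ..
  qed simp
  then show ?thesis
    using openin_eps_lambda_topology openin_topspace by (metis openin_subset subset_antisym)
qed

text \<open>The bound maps the ball of random radius \<open>e / c\<close> into the ball of radius
  \<open>e\<close>, which is continuity at the null element; additivity carries it to all other
  points.\<close>

lemma L0_convex_continuousI:
  assumes g: "g \<in> L0_hom M E" and Q: "Q \<subseteq> P" "finite Q" "Q \<noteq> {}" and c: "0 < c"
    and le: "\<And>x. x \<in> carrier E \<Longrightarrow>
               AE w in M. norm (L0_rep (g x) w) \<le> c * L0_rep (fin_norm M Q x) w"
  shows "g \<in> conj_L0_convex M E P"
proof -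
  have pull: "\<exists>N'\<in>L0_convex_base M E P. \<forall>y\<in>N'. y \<in> carrier E \<and> g y \<in> N"
    if "N \<in> L0_convex_base M (L0 M) {L0_abs M}" for N
  proof -
    from that obtain e where e: "e \<in> L0_pos M"
      and N: "N = {\<xi> \<in> carrier (L0 M). fin_norm M {L0_abs M} \<xi> \<sqsubseteq>\<^bsub>L0_order M\<^esub> e}"
      unfolding L0_convex_base_def by (auto simp: subset_singleton_iff simp del: L0_order_simps)
    define d where "d = L0_class M (\<lambda>w. L0_rep e w / c)"
    have ec: "e \<in> carrier (L0 M)" and epos: "AE w in M. 0 < L0_rep e w"
      using e by (auto simp: L0_pos_def)
    have m: "(\<lambda>w. L0_rep e w / c) \<in> borel_measurable M"
      using ec by (intro borel_measurable_divide) auto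
    have rd: "AE w in M. L0_rep d w = L0_rep e w / c"
      unfolding d_def using m by (rule AE_L0_rep_class)
    have "AE w in M. 0 < L0_rep d w"
      using rd epos by eventually_elim (use c in simp)
    then have d: "d \<in> L0_pos M"
      using m by (auto simp: L0_pos_def d_def)
    define N' where "N' = {x \<in> carrier E. fin_norm M Q x \<sqsubseteq>\<^bsub>L0_order M\<^esub> d}"
    have "N' \<in> L0_convex_base M E P"
      unfolding L0_convex_base_def N'_def using Q d by blast
    moreover have "g y \<in> N" if y: "y \<in> N'" for y
    proof -
      have yc: "y \<in> carrier E" and yd: "AE w in M. L0_rep (fin_norm M Q y) w \<le> L0_rep d w"
        using y by (auto simp: N'_def)
      have gy: "g y \<in> carrier (L0 M)" using hom_closed[OF g yc] .
      have "AE w in M. L0_rep (fin_norm M {L0_abs M} (g y)) w \<le> L0_rep e w"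
        using le[OF yc] yd rd AE_L0_rep_fin_norm_abs[OF gy]
      proof eventually_elim
        case (elim w)
        have "c * L0_rep (fin_norm M Q y) w \<le> c * (L0_rep e w / c)"
          using elim c by (intro mult_left_mono) auto
        with elim c show ?case by simp
      qed
      with gy show ?thesis by (simp add: N)
    qed
    ultimately show ?thesis
      by (intro bexI[of _ N']) (auto simp: N'_def simp del: L0_order_simps)
  qed
  have "L0_convex_base M (L0 M :: ('w \<Rightarrow> 'k) set ring) {L0_abs M} \<noteq> {}"
  proof -
    have "AE w in M. L0_rep (L0_class M (\<lambda>_. 1 :: real)) w = 1"
      by (intro AE_L0_rep_class) auto
    then have "L0_class M (\<lambda>_. 1) \<in> L0_pos M"
      by (auto simp: L0_pos_def)
    then show ?thesis unfolding L0_convex_base_def by blast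
  qed
  then obtain N0 :: "('w \<Rightarrow> 'k) set set" where N0: "N0 \<in> L0_convex_base M (L0 M) {L0_abs M}" by blast
  have "openin (L0_convex_topology M (L0 M) {L0_abs M}) (carrier (L0 M :: ('w \<Rightarrow> 'k) set ring))"
    unfolding openin_L0_convex_topology_L0
  proof (intro conjI ballI)
    fix \<xi> :: "('w \<Rightarrow> 'k) set" assume "\<xi> \<in> carrier (L0 M)"
    moreover have "N0 \<subseteq> carrier (L0 M)"
      using N0 unfolding L0_convex_base_def by blast
    ultimately have "(\<lambda>\<eta>. \<xi> \<oplus>\<^bsub>L0 M\<^esub> \<eta>) ` N0 \<subseteq> carrier (L0 M)"
      using E.R.a_closed by blast
    then show "\<exists>N\<in>L0_convex_base M (L0 M) {L0_abs M}. (\<lambda>\<eta>. \<xi> \<oplus>\<^bsub>L0 M\<^esub> \<eta>) ` N \<subseteq> carrier (L0 M)"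
      using N0 by blast
  qed simp
  then have top: "topspace (L0_convex_topology M (L0 M) {L0_abs M}) = carrier (L0 M :: ('w \<Rightarrow> 'k) set ring)"
    using openin_L0_convex_topology_L0 openin_topspace by (metis openin_subset subset_antisym)
  have topE: "topspace (L0_convex_topology M E P) \<subseteq> carrier E"
    using openin_L0_convex_topology openin_topspace by blast
  have op: "openin (L0_convex_topology M E P) {x \<in> carrier E. g x \<in> U}"
    if U: "openin (L0_convex_topology M (L0 M) {L0_abs M}) U" for U
    unfolding openin_L0_convex_topology
  proof safe
    fix x assume x: "x \<in> carrier E" "g x \<in> U"
    then obtain N where N: "N \<in> L0_convex_base M (L0 M) {L0_abs M}" "(\<lambda>y. g x \<oplus>\<^bsub>L0 M\<^esub> y) ` N \<subseteq> U"
      using U unfolding openin_L0_convex_topology_L0 by blast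
    from pull[OF N(1)] obtain N' where N': "N' \<in> L0_convex_base M E P" "\<forall>y\<in>N'. y \<in> carrier E \<and> g y \<in> N"
      by blast
    have "x \<oplus>\<^bsub>E\<^esub> y \<in> carrier E \<and> g (x \<oplus>\<^bsub>E\<^esub> y) \<in> U" if "y \<in> N'" for y
    proof -
      have "y \<in> carrier E" "g y \<in> N" using N' that by auto
      moreover have "g (x \<oplus>\<^bsub>E\<^esub> y) = g x \<oplus>\<^bsub>L0 M\<^esub> g y"
        using g x \<open>y \<in> carrier E\<close> by (auto simp: L0_hom_def simp del: L0_simps)
      ultimately show ?thesis using N(2) x by (auto simp del: L0_simps)
    qed
    then show "\<exists>N\<in>L0_convex_base M E P. (\<lambda>y. x \<oplus>\<^bsub>E\<^esub> y) ` N \<subseteq> {x \<in> carrier E. g x \<in> U}"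
      using N'(1) by blast
  qed
  \<comment> \<open>The preimage of the whole target is all of \<open>carrier E\<close>, so its
    openness already fixes the underlying space of the source.\<close>
  have "carrier E \<subseteq> topspace (L0_convex_topology M E P)"
    using op[OF openin_topspace] hom_closed[OF g] unfolding top by (auto dest!: openin_subset)
  with topE have topE: "topspace (L0_convex_topology M E P) = carrier E" by blast
  show ?thesis
    unfolding conj_L0_convex_def continuous_map_def top topE
    using g op hom_closed[OF g] by auto
qed

text \<open>\<open>?V\<close> must be a neighbourhood of each of its points, not just of the class
  of 0. Both strict inequalities at \<open>\<xi>\<close> leave room: shrinking the bound 1 slightly
  keeps the probability above \<open>1 - l\<close>, and a perturbation \<open>\<eta>\<close> may use
  up the two margins.\<close>

lemma openin_eps_lambda_L0:
  fixes l :: real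
  assumes "0 < l" "l < 1"
  shows "openin (eps_lambda_topology M (L0 M) {L0_abs M})
           {\<xi> \<in> carrier (L0 M :: ('w \<Rightarrow> 'k) set ring). 1 - l < prob {w \<in> space M. norm (L0_rep \<xi> w) < 1}}"
    (is "openin _ ?V")
  unfolding openin_eps_lambda_topology_L0
proof (intro conjI ballI)
  fix \<xi> assume \<xi>: "\<xi> \<in> ?V"
  then have [measurable]: "L0_rep \<xi> \<in> borel_measurable M" and \<xi>c: "\<xi> \<in> carrier (L0 M)"
    by auto
  \<comment> \<open>These events increase to the event that the norm of \<open>\<xi>\<close> is
    below 1, so some \<open>S n\<close> still has probability above \<open>1 - l\<close>.\<close>
  define S where "S n = {w \<in> space M. norm (L0_rep \<xi> w) < 1 - 1 / real (Suc n)}" for n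
  have "(\<lambda>n. prob (S n)) \<longlonglongrightarrow> prob (\<Union>n. S n)"
  proof (rule finite_Lim_measure_incseq)
    show "range S \<subseteq> events"
      unfolding S_def by auto
    show "incseq S"
    proof (rule incseq_SucI)
      fix n
      have "1 / real (Suc (Suc n)) \<le> 1 / real (Suc n)"
        by (simp add: field_simps)
      then show "S n \<le> S (Suc n)"
        unfolding S_def by (auto intro: less_le_trans)
    qed
  qed
  also have "(\<Union>n. S n) = {w \<in> space M. norm (L0_rep \<xi> w) < 1}"
  proof (intro equalityI subsetI)
    fix w assume w: "w \<in> {w \<in> space M. norm (L0_rep \<xi> w) < 1}"
    then obtain n where "1 / real (Suc n) < 1 - norm (L0_rep \<xi> w)"
      using nat_approx_posE[of "1 - norm (L0_rep \<xi> w)"] by auto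
    then have "norm (L0_rep \<xi> w) < 1 - 1 / real (Suc n)"
      by linarith
    with w show "w \<in> (\<Union>n. S n)"
      by (auto simp: S_def)
  next
    fix w assume "w \<in> (\<Union>n. S n)"
    then obtain n where "w \<in> space M" "norm (L0_rep \<xi> w) < 1 - 1 / real (Suc n)"
      by (auto simp: S_def)
    moreover have "0 < 1 / real (Suc n)" by simp
    ultimately have "norm (L0_rep \<xi> w) < 1" by linarith
    with \<open>w \<in> space M\<close> show "w \<in> {w \<in> space M. norm (L0_rep \<xi> w) < 1}"
      by simp
  qed
  finally have "eventually (\<lambda>n. 1 - l < prob (S n)) sequentially"
    using \<xi> by (intro order_tendstoD) auto
  then obtain n where n: "1 - l < prob (S n)"
    by (auto simp: eventually_sequentially)
  define r where "r = 1 / real (Suc n)"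
  \<comment> \<open>The margin in probability, capped at 1/2 because a basic neighbourhood needs a
    parameter below 1.\<close>
  define d where "d = min (prob (S n) - (1 - l)) (1/2)"
  have r: "0 < r" by (simp add: r_def)
  have d: "0 < d" "d < 1" using n by (auto simp: d_def)
  define N where "N = {\<eta> \<in> carrier (L0 M :: ('w \<Rightarrow> 'k) set ring).
    prob {w \<in> space M. L0_rep (fin_norm M {L0_abs M} \<eta>) w < r} > 1 - d}"
  have "N \<in> eps_lambda_base M (L0 M) {L0_abs M}"
    unfolding eps_lambda_base_def N_def using r d by blast
  moreover have "\<xi> \<oplus>\<^bsub>L0 M\<^esub> \<eta> \<in> ?V" if \<eta>: "\<eta> \<in> N" for \<eta>
  proof -
    have \<eta>c: "\<eta> \<in> carrier (L0 M)" using \<eta> by (simp add: N_def)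
    then have [measurable]: "L0_rep \<eta> \<in> borel_measurable M" by simp
    have c: "\<xi> \<oplus>\<^bsub>L0 M\<^esub> \<eta> \<in> carrier (L0 M)"
      using E.R.a_closed[OF \<xi>c \<eta>c] .
    then have [measurable]: "L0_rep (\<xi> \<oplus>\<^bsub>L0 M\<^esub> \<eta>) \<in> borel_measurable M"
      by (rule L0_rep_measurable)
    have Sm [measurable]: "S n \<in> events" by (simp add: S_def)
    define T where "T = {w \<in> space M. norm (L0_rep \<eta> w) < r}"
    have [measurable]: "T \<in> events" by (simp add: T_def)
    have "fin_norm M {L0_abs M} \<eta> \<in> carrier (L0 M)"
      using L0_abs_closed[OF \<eta>c] by (intro AE_L0_rep_fin_norm(1)) auto
    then have [measurable]: "L0_rep (fin_norm M {L0_abs M} \<eta>) \<in> borel_measurable M"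
      by simp
    have "prob {w \<in> space M. L0_rep (fin_norm M {L0_abs M} \<eta>) w < r} = prob T"
      using AE_L0_rep_fin_norm_abs[OF \<eta>c]
      by (intro finite_measure_eq_AE) (auto simp: T_def elim!: eventually_mono)
    then have T: "1 - d < prob T" using \<eta> by (simp add: N_def)
    have "prob (S n \<union> T) \<le> 1" by (rule prob_le_1)
    \<comment> \<open>Inclusion-exclusion bounds the probability of the intersection below by
      \<open>prob (S n) + prob T - 1\<close>, which exceeds \<open>prob (S n) - d\<close>.\<close>
    moreover have "prob (S n \<union> T) = prob (S n) + prob T - prob (S n \<inter> T)"
      by (intro measure_Un3) (auto simp: fmeasurable_eq_sets)
    ultimately have "1 - l < prob (S n \<inter> T)"
      using T by (simp add: d_def)
    also have "\<dots> \<le> prob {w \<in> space M. norm (L0_rep (\<xi> \<oplus>\<^bsub>L0 M\<^esub> \<eta>) w) < 1}"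
    proof (rule finite_measure_mono_AE)
      show "AE w in M. w \<in> S n \<inter> T \<longrightarrow> w \<in> {w \<in> space M. norm (L0_rep (\<xi> \<oplus>\<^bsub>L0 M\<^esub> \<eta>) w) < 1}"
        using AE_L0_rep_add[OF \<xi>c \<eta>c]
      proof eventually_elim
        case (elim w)
        have "norm (L0_rep \<xi> w + L0_rep \<eta> w) < 1" if "w \<in> S n \<inter> T"
          using that norm_triangle_ineq[of "L0_rep \<xi> w" "L0_rep \<eta> w"]
          by (simp add: S_def T_def r_def)
        with elim show ?case
          by (auto simp: S_def simp del: L0_simps)
      qed
    qed measurable
    finally show ?thesis using c by simp
  qed
  ultimately show "\<exists>N\<in>eps_lambda_base M (L0 M) {L0_abs M}. (\<lambda>\<eta>. \<xi> \<oplus>\<^bsub>L0 M\<^esub> \<eta>) ` N \<subseteq> ?V"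
    by blast
qed auto

section \<open>From continuity in probability to a norm bound off a small event\<close>

text \<open>The preimage of the open set \<open>?V\<close> contains a basic neighbourhood of the
  null element. Every \<open>x\<close> whose seminorm is almost surely small lies in it, whatever
  its probability parameter \<open>d\<close>.\<close>

lemma eps_lambda_continuous_at_zero:
  fixes l :: real
  assumes f: "f \<in> conj_eps_lambda M E P" and l: "0 < l" "l < 1"
  obtains Q e where "Q \<subseteq> P" "finite Q" "Q \<noteq> {}" "0 < e"
    "\<And>x. x \<in> carrier E \<Longrightarrow> AE w in M. L0_rep (fin_norm M Q x) w \<le> e \<Longrightarrow>
       prob {w \<in> space M. 1 \<le> norm (L0_rep (f x) w)} \<le> l"
proof -
  let ?V = "{\<xi> \<in> carrier (L0 M :: ('w \<Rightarrow> 'k) set ring). 1 - l < prob {w \<in> space M. norm (L0_rep \<xi> w) < 1}}"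
  have hom: "f \<in> L0_hom M E"
    and cont: "continuous_map (eps_lambda_topology M E P) (eps_lambda_topology M (L0 M) {L0_abs M}) f"
    using f by (auto simp: conj_eps_lambda_def)
  have fz: "f \<zero>\<^bsub>E\<^esub> \<in> carrier (L0 M)"
    using hom_closed[OF hom E.zero_closed] .
  \<comment> \<open>Additivity gives \<open>f \<zero> = f \<zero> + f \<zero>\<close>, so the
    representative vanishes almost everywhere.\<close>
  have "f \<zero>\<^bsub>E\<^esub> = f (\<zero>\<^bsub>E\<^esub> \<oplus>\<^bsub>E\<^esub> \<zero>\<^bsub>E\<^esub>)" by simp
  then have "AE w in M. L0_rep (f \<zero>\<^bsub>E\<^esub>) w = L0_rep (f \<zero>\<^bsub>E\<^esub>) w + L0_rep (f \<zero>\<^bsub>E\<^esub>) w"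
    using AE_hom_add[OF hom E.zero_closed E.zero_closed] by metis
  then have "AE w in M. w \<in> {w \<in> space M. norm (L0_rep (f \<zero>\<^bsub>E\<^esub>) w) < 1}"
    by (auto elim!: eventually_mono)
  moreover have [measurable]: "L0_rep (f \<zero>\<^bsub>E\<^esub>) \<in> borel_measurable M"
    using fz by simp
  have "{w \<in> space M. norm (L0_rep (f \<zero>\<^bsub>E\<^esub>) w) < 1} \<in> events"
    by measurable
  ultimately have "prob {w \<in> space M. norm (L0_rep (f \<zero>\<^bsub>E\<^esub>) w) < 1} = 1"
    by (subst prob_eq_1)
  with fz l have zV: "f \<zero>\<^bsub>E\<^esub> \<in> ?V" by simp
  have "openin (eps_lambda_topology M E P) {x \<in> carrier E. f x \<in> ?V}"
    using openin_continuous_map_preimage[OF cont openin_eps_lambda_L0[OF l]]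
    unfolding topspace_eps_lambda .
  then obtain N where N: "N \<in> eps_lambda_base M E P" "(\<lambda>y. \<zero>\<^bsub>E\<^esub> \<oplus>\<^bsub>E\<^esub> y) ` N \<subseteq> {x \<in> carrier E. f x \<in> ?V}"
    using zV unfolding openin_eps_lambda_topology by blast
  then obtain Q e d where Q: "Q \<subseteq> P" "finite Q" "Q \<noteq> {}" "0 < e" and d: "0 < d"
    and N_eq: "N = {x \<in> carrier E. prob {w \<in> space M. L0_rep (fin_norm M Q x) w < e} > 1 - d}"
    unfolding eps_lambda_base_def by blast
  show thesis
  \<comment> \<open>Halving turns the weak inequality of the claim into the strict one in the base,
    with probability 1.\<close>
  proof (rule that[of Q "e / 2"])
    fix x assume x: "x \<in> carrier E" and le: "AE w in M. L0_rep (fin_norm M Q x) w \<le> e / 2"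
    have [measurable]: "L0_rep (fin_norm M Q x) \<in> borel_measurable M"
      "L0_rep (f x) \<in> borel_measurable M"
      using fin_norm_closed[OF Q(1-3) x] hom_closed[OF hom x] by auto
    have "AE w in M. w \<in> {w \<in> space M. L0_rep (fin_norm M Q x) w < e}"
      using le AE_space by eventually_elim (use Q in auto)
    moreover have "{w \<in> space M. L0_rep (fin_norm M Q x) w < e} \<in> events"
      by measurable
    ultimately have "prob {w \<in> space M. L0_rep (fin_norm M Q x) w < e} = 1"
      by (subst prob_eq_1)
    then have "x \<in> N"
      using x d by (simp add: N_eq)
    then have "\<zero>\<^bsub>E\<^esub> \<oplus>\<^bsub>E\<^esub> x \<in> {x \<in> carrier E. f x \<in> ?V}"
      using N(2) by blast
    then have "1 - l < prob {w \<in> space M. norm (L0_rep (f x) w) < 1}"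
      using x by simp
    moreover have "prob (space M - {w \<in> space M. norm (L0_rep (f x) w) < 1})
        = 1 - prob {w \<in> space M. norm (L0_rep (f x) w) < 1}"
      by (intro prob_compl) measurable
    moreover have "space M - {w \<in> space M. norm (L0_rep (f x) w) < 1}
        = {w \<in> space M. 1 \<le> norm (L0_rep (f x) w)}"
      by auto
    ultimately show "prob {w \<in> space M. 1 \<le> norm (L0_rep (f x) w)} \<le> l"
      by simp
  qed (use Q in auto)
qed

lemma norm_bound_off_small_set:
  assumes f: "f \<in> L0_hom M E" and Q: "Q \<subseteq> P" "finite Q" "Q \<noteq> {}" and e: "0 < e"
    and small: "\<And>x. x \<in> carrier E \<Longrightarrow> AE w in M. L0_rep (fin_norm M Q x) w \<le> e \<Longrightarrow>
       prob {w \<in> space M. 1 \<le> norm (L0_rep (f x) w)} \<le> l"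
  obtains C where "C \<in> events" "prob C \<le> l"
    "\<And>x. x \<in> carrier E \<Longrightarrow>
       AE w in M. w \<notin> C \<longrightarrow> norm (L0_rep (f x) w) \<le> 1 / e * L0_rep (fin_norm M Q x) w"
proof -
  \<comment> \<open>All events on which some \<open>x\<close> of the ball has
    \<open>|f x| \<ge> 1\<close> almost surely. Admitting subevents and null exceptions makes the
    family closed under unions exactly, not only up to null sets.\<close>
  define \<C> where "\<C> = {A \<in> events. \<exists>x\<in>carrier E. (AE w in M. L0_rep (fin_norm M Q x) w \<le> e) \<and>
    (AE w in M. w \<in> A \<longrightarrow> 1 \<le> norm (L0_rep (f x) w))}"
  have meas: "L0_rep (f x) \<in> borel_measurable M" if "x \<in> carrier E" for x
    using hom_closed[OF f that] by simp
  have "\<exists>C\<in>events. prob C \<le> l \<and> (\<forall>A\<in>\<C>. AE w in M. w \<in> A \<longrightarrow> w \<in> C)"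
  proof (rule ess_union_of_directed)
    show "\<C> \<subseteq> events" by (auto simp: \<C>_def)
    \<comment> \<open>Written as a multiple by the zero scalar, the witness has vanishing seminorm
      by the scaling rule.\<close>
    let ?z = "\<zero>\<^bsub>L0 M\<^esub> \<odot>\<^bsub>E\<^esub> \<zero>\<^bsub>E\<^esub>"
    have "AE w in M. L0_rep (\<zero>\<^bsub>L0 M\<^esub> :: ('w \<Rightarrow> 'k) set) w = 0"
      by (auto intro!: AE_L0_rep_class)
    with AE_fin_norm_smult[OF Q E.R.zero_closed E.zero_closed]
    have "AE w in M. L0_rep (fin_norm M Q ?z) w \<le> e"
      by eventually_elim (use e in simp)
    then show "{} \<in> \<C>"
      unfolding \<C>_def using E.smult_closed[OF E.R.zero_closed E.zero_closed]
      by (auto simp del: L0_simps E.smult_r_null E.smult_l_null intro!: bexI[of _ ?z])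
  next
    fix A assume "A \<in> \<C>"
    then obtain x where A: "A \<in> events" and x: "x \<in> carrier E"
      and le: "AE w in M. L0_rep (fin_norm M Q x) w \<le> e"
      and ge: "AE w in M. w \<in> A \<longrightarrow> 1 \<le> norm (L0_rep (f x) w)"
      unfolding \<C>_def by blast
    have [measurable]: "L0_rep (f x) \<in> borel_measurable M" using meas[OF x] .
    have "prob A \<le> prob {w \<in> space M. 1 \<le> norm (L0_rep (f x) w)}"
    proof (rule finite_measure_mono_AE)
      show "AE w in M. w \<in> A \<longrightarrow> w \<in> {w \<in> space M. 1 \<le> norm (L0_rep (f x) w)}"
        using ge AE_space by eventually_elim auto
    qed measurable
    also have "\<dots> \<le> l" using small[OF x le] .
    finally show "prob A \<le> l" .
  next
    fix A B assume "A \<in> \<C>" "B \<in> \<C>"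
    then obtain x y where A: "A \<in> events" and x: "x \<in> carrier E"
      and lex: "AE w in M. L0_rep (fin_norm M Q x) w \<le> e"
      and gex: "AE w in M. w \<in> A \<longrightarrow> 1 \<le> norm (L0_rep (f x) w)"
      and B: "B \<in> events" and y: "y \<in> carrier E"
      and ley: "AE w in M. L0_rep (fin_norm M Q y) w \<le> e"
      and gey: "AE w in M. w \<in> B \<longrightarrow> 1 \<le> norm (L0_rep (f y) w)"
      unfolding \<C>_def by blast
    define I J where "I = (L0_ind M A :: ('w \<Rightarrow> 'k) set)" and "J = (L0_ind M (space M - A) :: ('w \<Rightarrow> 'k) set)"
    have Ac: "space M - A \<in> events" using A by auto
    have I: "I \<in> carrier (L0 M)" and J: "J \<in> carrier (L0 M)"
      and rI: "AE w in M. L0_rep I w = indicator A w"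
      and rJ: "AE w in M. L0_rep J w = indicator (space M - A) w"
      unfolding I_def J_def using A Ac by (auto intro: L0_ind_closed AE_L0_rep_ind)
    have Ix: "I \<odot>\<^bsub>E\<^esub> x \<in> carrier E" and Jy: "J \<odot>\<^bsub>E\<^esub> y \<in> carrier E"
      using I J x y by auto
    \<comment> \<open>\<open>x\<close> on \<open>A\<close> and \<open>y\<close> off
      \<open>A\<close>. The seminorm stays at most \<open>e\<close> because the indicators never
      overlap, and a point of \<open>A \<union> B\<close> off \<open>A\<close> lies in
      \<open>B\<close>, where \<open>y\<close> serves.\<close>
    let ?z = "I \<odot>\<^bsub>E\<^esub> x \<oplus>\<^bsub>E\<^esub> J \<odot>\<^bsub>E\<^esub> y"
    have "AE w in M. L0_rep (fin_norm M Q ?z) w \<le> e"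
      using AE_fin_norm_add[OF Q Ix Jy] AE_fin_norm_smult[OF Q I x] AE_fin_norm_smult[OF Q J y]
        rI rJ lex ley AE_space
    proof eventually_elim
      case (elim w)
      then show ?case by (cases "w \<in> A") auto
    qed
    moreover have "AE w in M. w \<in> A \<union> B \<longrightarrow> 1 \<le> norm (L0_rep (f ?z) w)"
      using AE_hom_add[OF f Ix Jy] AE_hom_smult[OF f I x] AE_hom_smult[OF f J y]
        rI rJ gex gey AE_space
    proof eventually_elim
      case (elim w)
      then show ?case by (cases "w \<in> A") auto
    qed
    ultimately show "A \<union> B \<in> \<C>"
      unfolding \<C>_def using A B E.a_closed[OF Ix Jy] by blast
  qed
  then obtain C where C: "C \<in> events" "prob C \<le> l"
    and CC: "\<And>A. A \<in> \<C> \<Longrightarrow> AE w in M. w \<in> A \<longrightarrow> w \<in> C"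
    by blast
  have "AE w in M. w \<notin> C \<longrightarrow> norm (L0_rep (f x) w) \<le> 1 / e * L0_rep (fin_norm M Q x) w"
    if x: "x \<in> carrier E" for x
  proof -
    let ?q = "\<lambda>w. L0_rep (fin_norm M Q x) w"
    have [measurable]: "?q \<in> borel_measurable M"
      using fin_norm_closed[OF Q x] by simp
    have step: "AE w in M. w \<notin> C \<longrightarrow> norm (L0_rep (f x) w) \<le> (?q w + t) / e" if t: "0 < t" for t
    proof -
      \<comment> \<open>\<open>t > 0\<close> keeps the denominator away from \<open>0\<close>; it tends to \<open>0\<close> at the end.\<close>
      define h where "h w = (of_real (e / (?q w + t)) :: 'k)" for w
      have [measurable]: "h \<in> borel_measurable M"
        unfolding h_def by measurable
      have norm_h: "norm (h w) = e / (?q w + t)" if "0 \<le> ?q w" for w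
        using that e t unfolding h_def norm_of_real by simp
      define \<xi> where "\<xi> = L0_class M h"
      have \<xi>: "\<xi> \<in> carrier (L0 M)" and r\<xi>: "AE w in M. L0_rep \<xi> w = h w"
        unfolding \<xi>_def by (auto intro: AE_L0_rep_class)
      have y: "\<xi> \<odot>\<^bsub>E\<^esub> x \<in> carrier E" using \<xi> x by auto
      have [measurable]: "L0_rep (f (\<xi> \<odot>\<^bsub>E\<^esub> x)) \<in> borel_measurable M" using meas[OF y] .
      have nn: "AE w in M. 0 \<le> ?q w" using AE_fin_norm_nonneg[OF Q x] .
      have "AE w in M. L0_rep (fin_norm M Q (\<xi> \<odot>\<^bsub>E\<^esub> x)) w \<le> e"
        using AE_fin_norm_smult[OF Q \<xi> x] r\<xi> nn
      proof eventually_elim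
        case (elim w)
        have "e / (?q w + t) * ?q w \<le> e"
          using elim t e by (simp add: field_simps)
        with elim show ?case by (simp add: norm_h)
      qed
      \<comment> \<open>The rescaled element lies in the ball, so off \<open>C\<close> its image has
        norm below 1; solving for the norm of \<open>f x\<close> gives the bound.\<close>
      then have "{w \<in> space M. 1 \<le> norm (L0_rep (f (\<xi> \<odot>\<^bsub>E\<^esub> x)) w)} \<in> \<C>"
        unfolding \<C>_def using y by (auto intro!: bexI[of _ "\<xi> \<odot>\<^bsub>E\<^esub> x"])
      from CC[OF this] show ?thesis
        using AE_hom_smult[OF f \<xi> x] r\<xi> nn AE_space
      proof eventually_elim
        case (elim w)
        show ?case
        proof
          assume "w \<notin> C"
          then have "norm (h w * L0_rep (f x) w) < 1"
            using elim by auto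
          then have "e / (?q w + t) * norm (L0_rep (f x) w) < 1"
            using elim by (simp add: norm_h norm_mult)
          then show "norm (L0_rep (f x) w) \<le> (?q w + t) / e"
            using elim t e by (simp add: field_simps)
        qed
      qed
    qed
    \<comment> \<open>Only countably many values of \<open>t\<close> are taken, so one null set
      serves for all of them.\<close>
    have "AE w in M. \<forall>n. w \<notin> C \<longrightarrow> norm (L0_rep (f x) w) \<le> (?q w + 1 / real (Suc n)) / e"
      unfolding AE_all_countable by (intro allI step) simp
    then show ?thesis
    proof eventually_elim
      case (elim w)
      have "(\<lambda>n. (?q w + 1 / real (Suc n)) / e) \<longlonglongrightarrow> (?q w + 0) / e"
        using e by (intro tendsto_intros LIMSEQ_Suc[OF lim_1_over_n]) auto
      then show ?case
        using elim by (auto intro!: LIMSEQ_le_const)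
    qed
  qed
  with C show thesis by (rule that)
qed

section \<open>Concatenation along a countable partition\<close>

lemma conj_eps_lambda_subset_cc_hull:
  assumes f: "f \<in> conj_eps_lambda M E P"
  shows "f \<in> cc_hull M E (conj_eps_lambda M E P) (conj_L0_convex M E P)"
proof -
  have hom: "f \<in> L0_hom M E"
    using f by (simp add: conj_eps_lambda_def)
  \<comment> \<open>The level is \<open>1 / (n + 2)\<close> because continuity at the null element
    is used with a level strictly below 1, already at \<open>n = 0\<close>.\<close>
  define R where "R n C Q e \<longleftrightarrow> C \<in> events \<and> prob C \<le> 1 / real (Suc (Suc n)) \<and>
      Q \<subseteq> P \<and> finite Q \<and> Q \<noteq> {} \<and> 0 < e \<and>
      (\<forall>x\<in>carrier E. AE w in M. w \<notin> C \<longrightarrow>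
         norm (L0_rep (f x) w) \<le> 1 / e * L0_rep (fin_norm M Q x) w)" for n C Q e
  have "\<exists>C Q e. R n C Q e" for n
  proof -
    have l: "0 < 1 / real (Suc (Suc n))" "1 / real (Suc (Suc n)) < 1" by auto
    obtain Q e where Q: "Q \<subseteq> P" "finite Q" "Q \<noteq> {}" "0 < e"
      and small: "\<And>x. x \<in> carrier E \<Longrightarrow> AE w in M. L0_rep (fin_norm M Q x) w \<le> e \<Longrightarrow>
       prob {w \<in> space M. 1 \<le> norm (L0_rep (f x) w)} \<le> 1 / real (Suc (Suc n))"
      by (rule eps_lambda_continuous_at_zero[OF f l]) (rule that; assumption)
    obtain C where "C \<in> events" "prob C \<le> 1 / real (Suc (Suc n))"
      "\<And>x. x \<in> carrier E \<Longrightarrow>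
       AE w in M. w \<notin> C \<longrightarrow> norm (L0_rep (f x) w) \<le> 1 / e * L0_rep (fin_norm M Q x) w"
      by (rule norm_bound_off_small_set[OF hom Q small]) (auto intro: that)
    with Q show ?thesis unfolding R_def by (intro exI[of _ C] exI[of _ Q] exI[of _ e]) simp
  qed
  then obtain C Q e where R: "\<And>n. R n (C n) (Q n) (e n)"
    by metis
  have C: "C n \<in> events" "prob (C n) \<le> 1 / real (Suc (Suc n))"
    and Q: "Q n \<subseteq> P" "finite (Q n)" "Q n \<noteq> {}" "0 < e n"
    and bound: "x \<in> carrier E \<Longrightarrow> AE w in M. w \<notin> C n \<longrightarrow>
         norm (L0_rep (f x) w) \<le> 1 / e n * L0_rep (fin_norm M (Q n) x) w" for n x
    using R[of n] unfolding R_def by blast+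
  define Z where "Z = (\<Inter>n. C n)"
  have Z: "Z \<in> events" unfolding Z_def using C by auto
  have "prob Z \<le> 1 / real (Suc (Suc n))" for n
    using C by (intro order_trans[OF _ C(2)[of n]] finite_measure_mono) (auto simp: Z_def)
  then have "prob Z \<le> 0"
    using LIMSEQ_Suc[OF LIMSEQ_Suc[OF lim_1_over_n]] by (intro LIMSEQ_le_const) auto
  then have "prob Z = 0" using measure_nonneg[of M Z] by linarith
  then have AEZ: "AE w in M. w \<notin> Z"
    using Z by (intro AE_not_in) (auto simp: null_sets_def emeasure_eq_measure)
  \<comment> \<open>The null set \<open>Z\<close> is added so that the union is exactly \<open>space M\<close>.\<close>
  define B where "B n = (space M - C n) \<union> Z" for n
  have B: "range B \<subseteq> events" using C Z by (auto simp: B_def)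
  define A where "A = disjointed B"
  have A: "range A \<subseteq> events" unfolding A_def using B by (rule sets.range_disjointed_sets)
  have "(\<Union>n. B n) = space M"
    using sets.sets_into_space[OF Z] by (auto simp: B_def Z_def)
  then have part: "countable_partition M A"
    using A unfolding countable_partition_def A_def
    by (simp add: disjoint_family_disjointed UN_disjointed_eq)
  define I where "I n = (L0_ind M (A n) :: ('w \<Rightarrow> 'k) set)" for n
  have I: "I n \<in> carrier (L0 M)" and rI: "AE w in M. L0_rep (I n) w = indicator (A n) w" for n
    unfolding I_def using A by (auto intro!: L0_ind_closed AE_L0_rep_ind)
  \<comment> \<open>Each piece is \<open>f\<close> itself cut down to \<open>A n\<close>; agreement
    with \<open>f\<close> on \<open>A n\<close> is then idempotence of the indicator class.\<close>
  define g where "g n = hom_smult M E (I n) f" for n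
  have g_app: "g n x = I n \<otimes>\<^bsub>L0 M\<^esub> f x" if "x \<in> carrier E" for n x
    using that by (simp add: g_def hom_smult_def)
  have "g n \<in> conj_L0_convex M E P" for n
  proof (rule L0_convex_continuousI[OF _ Q(1-3)])
    show "g n \<in> L0_hom M E"
      unfolding g_def using hom I by (rule hom_smult_in_L0_hom)
    show "0 < 1 / e n" using Q(4)[of n] by simp
    fix x assume x: "x \<in> carrier E"
    have fx: "f x \<in> carrier (L0 M)" using hom_closed[OF hom x] .
    show "AE w in M. norm (L0_rep (g n x) w) \<le> 1 / e n * L0_rep (fin_norm M (Q n) x) w"
      unfolding g_app[OF x]
      using AE_L0_rep_mult[OF I[of n] fx] rI[of n] bound[OF x, of n] AEZ AE_fin_norm_nonneg[OF Q(1-3)[of n] x]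
    proof eventually_elim
      case (elim w)
      \<comment> \<open>Outside the null set \<open>Z\<close>, a point of \<open>A n\<close> avoids
        \<open>C n\<close>, so the bound for \<open>f\<close> applies; off \<open>A n\<close> the
        left side is 0 and the right side nonnegative.\<close>
      have "A n \<subseteq> B n" unfolding A_def by (rule disjointed_subset)
      then have "w \<in> A n \<Longrightarrow> w \<notin> C n" using elim(4) by (auto simp: B_def)
      then show ?case
        using elim Q(4)[of n] by (cases "w \<in> A n") (auto simp del: L0_simps)
    qed
  qed
  moreover have "hom_smult M E (I n) f = hom_smult M E (I n) (g n)" for n
  proof (rule ext)
    fix x
    show "hom_smult M E (I n) f x = hom_smult M E (I n) (g n) x"
    proof (cases "x \<in> carrier E")
      case True
      have fx: "f x \<in> carrier (L0 M)" using hom_closed[OF hom True] .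
      have c: "I n \<otimes>\<^bsub>L0 M\<^esub> f x \<in> carrier (L0 M)" using I fx by (rule E.R.m_closed)
      have "I n \<otimes>\<^bsub>L0 M\<^esub> f x = I n \<otimes>\<^bsub>L0 M\<^esub> (I n \<otimes>\<^bsub>L0 M\<^esub> f x)"
      proof (rule L0_eqI[OF c E.R.m_closed[OF I c]])
        show "AE w in M. L0_rep (I n \<otimes>\<^bsub>L0 M\<^esub> f x) w = L0_rep (I n \<otimes>\<^bsub>L0 M\<^esub> (I n \<otimes>\<^bsub>L0 M\<^esub> f x)) w"
          using AE_L0_rep_mult[OF I[of n] fx] AE_L0_rep_mult[OF I[of n] c] rI[of n]
          by eventually_elim (simp add: indicator_def del: L0_simps)
      qed
      then show ?thesis
        using True g_app[OF True] unfolding hom_smult_def by (simp del: L0_simps)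
    qed (simp add: hom_smult_def)
  qed
  ultimately show ?thesis
    unfolding cc_hull_def I_def using f part by blast
qed

end

theorem theorem3p7:
  fixes M :: "'w measure"
    and E :: "(('w \<Rightarrow> 'k::{real_normed_field, euclidean_space}) set, 'e, 'm) module_scheme"
    and P :: "('e \<Rightarrow> ('w \<Rightarrow> real) set) set"
  assumes "RLC_module M E P"
  shows "conj_eps_lambda M E P = cc_hull M E (conj_eps_lambda M E P) (conj_L0_convex M E P)"
proof
  show "conj_eps_lambda M E P \<subseteq> cc_hull M E (conj_eps_lambda M E P) (conj_L0_convex M E P)"
    using RLC_module.conj_eps_lambda_subset_cc_hull[OF assms] by blast
  show "cc_hull M E (conj_eps_lambda M E P) (conj_L0_convex M E P) \<subseteq> conj_eps_lambda M E P"
    by (simp add: cc_hull_def)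
qed

end
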